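(* Let $d,n\ge1$, let $\mathbf{Q}=(Q_1,\dots,Q_n)$ be an $n$-tuple of real quadratic forms in $d$ variables, and let $\varphi\in C_c^\infty(\mathbb{R}^d)$ with $\varphi\not\equiv0$. There is a constant $C$ (depending on $\mathbf{Q}$ and $\varphi$) such that $$|\widetilde E^{\mathbf{Q}}_\varphi1(x)|\le C(1+|x|)^{-\frac{\mathfrak{d}_{d,1}(\mathbf{Q})}{2}},\qquad x\in\mathbb{R}^{d+n}.$$ Moreover this bound is optimal: for no $\gamma>\frac{\mathfrak{d}_{d,1}(\mathbf{Q})}{2}$ does there exist a constant $C$ with $|\widetilde E_\varphi^{\mathbf{Q}}1(x)|\le C(1+|x|)^{-\gamma}$ for all $x\in\mathbb{R}^{d+n}$.
   Context: $\widetilde E_\varphi^{\mathbf{Q}}f(x)=\int_{\mathbb{R}^d}e^{ix\cdot(\xi,\mathbf{Q}(\xi))}f(\xi)\varphi(\xi)\,d\xi$ for $x\in\mathbb{R}^{d+n}$, so $\widetilde E_\varphi^{\mathbf{Q}}1(x)=\int_{\mathbb{R}^d}e^{ix\cdot(\xi,\mathbf{Q}(\xi))}\varphi(\xi)\,d\xi$. $\mathfrak{d}_{d,1}(\mathbf{Q})=\inf_{M\in\mathrm{GL}(d,\mathbb{R})}\inf_{N\in\mathbb{R}^{n\times1},\,N\ne0}\mathrm{NV}((\mathbf{Q}\circ M)\cdot N)$, where $\mathrm{NV}$ of a quadratic form in $d$ variables is the number of indices $i\in\{1,\dots,d\}$ such that its partial derivative $\partial_{\xi_i}$ is not identically zero.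 *)

theory Defs
  imports "HOL-Analysis.Analysis"
begin

definition partial_deriv ::
  "'d \<Rightarrow> (real ^ 'd \<Rightarrow> 'b::real_normed_vector) \<Rightarrow> real ^ 'd \<Rightarrow> 'b" where
  "partial_deriv i f x = vector_derivative (\<lambda>t. f (x + t *\<^sub>R axis i 1)) (at 0)"

primrec C_diff :: "nat \<Rightarrow> (real ^ 'd \<Rightarrow> 'b::real_normed_vector) \<Rightarrow> bool" where
  "C_diff 0 f \<longleftrightarrow> continuous_on UNIV f"
| "C_diff (Suc k) f \<longleftrightarrow> f differentiable_on UNIV \<and> (\<forall>i. C_diff k (partial_deriv i f))"

definition test_function :: "(real ^ 'd \<Rightarrow> 'b::real_normed_vector) \<Rightarrow> bool" where
  "test_function \<phi> \<longleftrightarrow> (\<forall>k. C_diff k \<phi>) \<and> compact (closure {\<xi>. \<phi> \<xi> \<noteq> 0})"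

definition quadratic_form :: "(real ^ 'd \<Rightarrow> real) \<Rightarrow> bool" where
  "quadratic_form q \<longleftrightarrow> (\<exists>A :: real ^ 'd ^ 'd. \<forall>\<xi>. q \<xi> = \<xi> \<bullet> (A *v \<xi>))"

definition NV :: "(real ^ 'd \<Rightarrow> real) \<Rightarrow> nat" where
  "NV q = card {i. \<exists>\<xi>. partial_deriv i q \<xi> \<noteq> 0}"

text \<open>A tuple of \<open>n\<close> forms is a map into \<open>\<real>\<^sup>n\<close>, and an \<open>n \<times> 1\<close> matrix \<open>N\<close> is a vector in
  \<open>\<real>\<^sup>n\<close>, so \<open>(Q \<circ> M) \<cdot> N\<close> is the inner product below. The infima are taken in the naturals,
  over nonempty index sets.\<close>

definition d_frak1 :: "(real ^ 'd \<Rightarrow> real ^ 'n) \<Rightarrow> nat" where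
  "d_frak1 Q = (INF M \<in> {M :: real ^ 'd ^ 'd. invertible M}.
                  INF N \<in> {N :: real ^ 'n. N \<noteq> 0}. NV (\<lambda>\<xi>. Q (M *v \<xi>) \<bullet> N))"

text \<open>The space \<open>\<real>\<^sup>d\<^sup>+\<^sup>n\<close> is the product \<open>\<real>\<^sup>d \<times> \<real>\<^sup>n\<close>, whose norm and inner product are the
  Euclidean ones.\<close>

definition ext_op ::
  "(real ^ 'd \<Rightarrow> real ^ 'n) \<Rightarrow> (real ^ 'd \<Rightarrow> complex) \<Rightarrow> (real ^ 'd \<Rightarrow> complex)
    \<Rightarrow> (real ^ 'd) \<times> (real ^ 'n) \<Rightarrow> complex" where
  "ext_op Q \<phi> f x =
    (LINT \<xi>|lborel. exp (\<i> * complex_of_real (x \<bullet> (\<xi>, Q \<xi>))) * f \<xi> * \<phi> \<xi>)"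

end

theory Submission
  imports Defs "HOL-Complex_Analysis.Cauchy_Integral_Theorem" "HOL-Probability.Distributions"
    "HOL-Real_Asymp.Real_Asymp"
begin

text \<open>
Let \<open>m\<close> be the number \<open>d_frak1 Q\<close>. A scalar form \<open>Q \<bullet> N\<close> has a symmetric matrix, and after the change of
variables \<open>M\<close> it depends on exactly those variables whose column of \<open>M\<close> is not annihilated by this matrix. Hence
\<open>m\<close> is the smallest rank of \<open>Q \<bullet> N\<close> over all \<open>N \<noteq> 0\<close>. Write the frequency as \<open>x = (y, z)\<close>.

Upper bound. In an orthonormal eigenbasis of the matrix of \<open>Q \<bullet> (z / \<bar>z\<bar>)\<close> the phase is a sum of one-dimensional
quadratic phases, and at least \<open>m\<close> of the eigenvalues are nonzero. A one-dimensional factor with eigenvalue \<open>l\<close> has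
a primitive of size \<open>C / sqrt (\<bar>z\<bar> \<bar>l\<bar>)\<close> (\<open>quadratic_phase_primitive\<close>), so integrating by parts once in each of \<open>m\<close>
eigendirections (\<open>oscillatory_integral_multi_parts\<close>) gains \<open>\<bar>z\<bar> powr (- m / 2)\<close>. Compactness of the set of unit
vectors \<open>N\<close> and orthonormal bases bounds the product of the \<open>m\<close> eigenvalues from below
(\<open>d_frak1_uniform_minor\<close>), so the estimate is uniform in the direction of \<open>z\<close>. When \<open>y\<close> dominates, integrating by
parts in the coordinate directions trades each factor \<open>\<bar>y\<bar>\<close> for a factor \<open>1 + \<bar>z\<bar>\<close> without losing the gain just
obtained (\<open>osc_decay_in_tangential_direction\<close>); \<open>m\<close> such steps give the decay in \<open>\<bar>x\<bar>\<close>.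

Optimality. The argument is by duality. Choose \<open>N\<close> of minimal rank \<open>m\<close>. In
an eigendirection with eigenvalue \<open>l\<close> the function \<open>exp (- (a + \<i> t l) s\<^sup>2)\<close> is an average of characters of total
mass \<open>sqrt (\<bar>a + \<i> t l\<bar> / a)\<close> (\<open>gaussian_as_average_of_characters\<close>), which is of order \<open>sqrt t\<close> for the \<open>m\<close> nonzero
eigenvalues and equal to 1 for the others. Multiplying \<open>exp (\<i> t (Q \<bullet> N)) \<phi>\<close> by these functions removes the
oscillation, so a decay of order \<open>t powr (- \<gamma>)\<close>, uniform in \<open>y\<close>, bounds the Gaussian means of \<open>\<phi>\<close> by a multiple of
\<open>t powr (m / 2 - \<gamma>)\<close>. If \<open>\<gamma> > m / 2\<close> all these means vanish, and then \<open>\<phi> = 0\<close>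
(\<open>gaussian_means_determine_value\<close>).
\<close>

section \<open>Integration by parts on Euclidean space\<close>

lemma integrable_continuous_bounded_support:
  fixes f :: "'a::euclidean_space \<Rightarrow> complex"
  assumes "continuous_on UNIV f" "\<And>x. norm x > R \<Longrightarrow> f x = 0"
  shows "integrable lborel f"
proof -
  have "integrable lborel (\<lambda>x. indicator (cball 0 R) x *\<^sub>R f x)"
    using assms(1) by (intro borel_integrable_compact) (auto intro: continuous_on_subset)
  also have "(\<lambda>x. indicator (cball 0 R) x *\<^sub>R f x) = f"
    using assms(2) by (auto simp: fun_eq_iff indicator_def not_le)
  finally show ?thesis .
qed

lemma integral_lborel_translation:
  fixes f :: "'a::euclidean_space \<Rightarrow> complex"
  assumes "f \<in> borel_measurable borel"
  shows "(LINT x|lborel. f (x + a)) = (LINT x|lborel. f x)"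
proof -
  have "(LINT x|lborel. f x) = (LINT x|distr lborel borel ((+) a). f x)"
    by (simp add: lborel_distr_plus)
  also have "\<dots> = (LINT x|lborel. f (a + x))"
    using assms by (intro integral_distr) auto
  finally show ?thesis by (simp add: add.commute)
qed

lemma has_vector_derivative_line_everywhere:
  fixes h :: "'a::real_normed_vector \<Rightarrow> complex"
  assumes "\<And>x. ((\<lambda>s. h (x + s *\<^sub>R u)) has_vector_derivative h' x) (at 0)"
  shows "((\<lambda>s. h (x + s *\<^sub>R u)) has_vector_derivative h' (x + t *\<^sub>R u)) (at t)"
proof -
  have "((\<lambda>s. h ((x + t *\<^sub>R u) + s *\<^sub>R u)) has_derivative (\<lambda>r. r *\<^sub>R h' (x + t *\<^sub>R u))) (at (t - t))"
    using assms[of "x + t *\<^sub>R u"] by (simp add: has_vector_derivative_def)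
  moreover have "((\<lambda>s. s - t) has_derivative (\<lambda>r. r)) (at t)"
    by (auto intro!: derivative_eq_intros)
  ultimately have "((\<lambda>s. h ((x + t *\<^sub>R u) + (s - t) *\<^sub>R u)) has_derivative (\<lambda>r. r *\<^sub>R h' (x + t *\<^sub>R u))) (at t)"
    using has_derivative_compose[of "\<lambda>s. s - t" "\<lambda>r. r" t UNIV] by fastforce
  then show ?thesis
    by (simp add: has_vector_derivative_def algebra_simps)
qed

text \<open>Integration by parts against a factor that is constant along the direction of differentiation:
the difference quotients of \<open>h\<close> along \<open>u\<close> have zero integral against such a weight by translation
invariance of Lebesgue measure, and they converge to the derivative boundedly. The weight will carry the
oscillation in the directions orthogonal to \<open>u\<close>.\<close>

lemma integral_directional_derivative_eq_0:
  fixes h h' W :: "'a::euclidean_space \<Rightarrow> complex"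
  assumes ch: "continuous_on UNIV h" and ch': "continuous_on UNIV h'"
    and der: "\<And>x. ((\<lambda>s. h (x + s *\<^sub>R u)) has_vector_derivative h' x) (at 0)"
    and supp: "\<And>x. norm x > R \<Longrightarrow> h x = 0"
    and cW: "continuous_on UNIV W" and bW: "\<And>x. norm (W x) \<le> 1"
    and inv: "\<And>x s. W (x + s *\<^sub>R u) = W x"
  shows "(LINT x|lborel. W x * h' x) = 0"
proof -
  have h'0: "h' x = 0" if "norm x > R" for x
  proof -
    have "eventually (\<lambda>s. norm (x + s *\<^sub>R u) > R) (at 0)"
    proof -
      have "((\<lambda>s. norm (x + s *\<^sub>R u)) \<longlongrightarrow> norm (x + 0 *\<^sub>R u)) (at 0)"
        by (intro tendsto_intros)
      then show ?thesis using that by (simp add: order_tendstoD)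
    qed
    then have "eventually (\<lambda>s. h (x + s *\<^sub>R u) = 0) (at 0)"
      by (rule eventually_mono) (rule supp)
    then have ev: "eventually (\<lambda>s. 0 = h (x + s *\<^sub>R u)) (at 0)"
      by (rule eventually_mono) simp
    have "((\<lambda>s. h (x + s *\<^sub>R u)) has_vector_derivative 0) (at 0)"
      unfolding has_vector_derivative_def
      by (rule has_derivative_transform_eventually[OF _ ev]) (use supp[OF that] in auto)
    with der[of x] show "h' x = 0" by (rule vector_derivative_unique_at)
  qed
  have "compact (h' ` cball 0 R)"
    by (intro compact_continuous_image continuous_on_subset[OF ch']) auto
  then obtain M where M: "\<And>x. x \<in> cball 0 R \<Longrightarrow> norm (h' x) \<le> M" and M0: "M > 0"
    unfolding bounded_pos by (metis compact_imp_bounded bounded_pos imageI)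
  have Mall: "norm (h' x) \<le> M" for x
    using M[of x] h'0[of x] M0 by (cases "norm x > R") auto
  have lip: "norm (h (x + s *\<^sub>R u) - h x) \<le> M * \<bar>s\<bar>" for x s
  proof -
    have "norm ((\<lambda>s. h (x + s *\<^sub>R u)) s - (\<lambda>s. h (x + s *\<^sub>R u)) 0) \<le> M * norm (s - 0)"
    proof (rule differentiable_bound[of UNIV _ "\<lambda>t r. r *\<^sub>R h' (x + t *\<^sub>R u)"])
      fix t
      show "((\<lambda>s. h (x + s *\<^sub>R u)) has_derivative (\<lambda>r. r *\<^sub>R h' (x + t *\<^sub>R u))) (at t within UNIV)"
        using has_vector_derivative_line_everywhere[of h u h', OF der] by (simp add: has_vector_derivative_def)
      show "onorm (\<lambda>r. r *\<^sub>R h' (x + t *\<^sub>R u)) \<le> M"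
        using Mall by (intro onorm_le) (auto simp: mult.commute[of M] intro!: mult_left_mono)
    qed auto
    then show ?thesis by simp
  qed
  \<comment> \<open>The difference quotients along \<open>u\<close> with step \<open>1 / Suc n\<close>; by \<open>lip\<close> they are dominated by \<open>M\<close>.\<close>
  define D where "D n x = of_nat (Suc n) * (h (x + (1 / real (Suc n)) *\<^sub>R u) - h x)" for n x
  have meas[measurable]: "h \<in> borel_measurable borel" "h' \<in> borel_measurable borel" "W \<in> borel_measurable borel"
    using ch ch' cW by (auto intro: borel_measurable_continuous_onI)
  have int_h: "integrable lborel (\<lambda>x. W x * h (x + a))" for a
  proof (rule integrable_continuous_bounded_support[where R = "R + norm a"])
    show "continuous_on UNIV (\<lambda>x. W x * h (x + a))"
      by (intro continuous_intros cW continuous_on_compose2[OF ch]) auto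
    show "W x * h (x + a) = 0" if "norm x > R + norm a" for x
    proof -
      have "norm x \<le> norm (x + a) + norm a"
        using norm_triangle_ineq4[of "x + a" a] by simp
      then show ?thesis using that supp[of "x + a"] by auto
    qed
  qed
  have zero: "(LINT x|lborel. W x * D n x) = 0" for n
  proof -
    let ?a = "(1 / real (Suc n)) *\<^sub>R u"
    have "(LINT x|lborel. W x * D n x) = (LINT x|lborel. of_nat (Suc n) * (W x * h (x + ?a) - W x * h (x + 0)))"
      by (simp add: D_def algebra_simps)
    also have "\<dots> = of_nat (Suc n) * ((LINT x|lborel. W x * h (x + ?a)) - (LINT x|lborel. W x * h (x + 0)))"
      using int_h[of ?a] int_h[of 0] by (simp add: Bochner_Integration.integral_diff)
    also have "(LINT x|lborel. W x * h (x + ?a)) = (LINT x|lborel. W (x + ?a) * h (x + ?a))"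
      by (simp only: inv)
    also have "\<dots> = (LINT x|lborel. W x * h x)"
      by (rule integral_lborel_translation[where f = "\<lambda>x. W x * h x"]) measurable
    finally show ?thesis by simp
  qed
  have "(\<lambda>n. LINT x|lborel. W x * D n x) \<longlonglongrightarrow> (LINT x|lborel. W x * h' x)"
  proof (rule integral_dominated_convergence[where w = "\<lambda>x. M * indicat_real (cball 0 (R + norm u)) x"])
    show "(\<lambda>x. W x * h' x) \<in> borel_measurable lborel" by simp
    show "(\<lambda>x. W x * D n x) \<in> borel_measurable lborel" for n
      unfolding D_def by simp
    show "integrable lborel (\<lambda>x. M * indicat_real (cball 0 (R + norm u)) x)"
      using emeasure_lborel_cball_finite by (auto simp: integrable_indicator_iff intro!: integrable_mult_right)
    show "AE x in lborel. (\<lambda>n. W x * D n x) \<longlonglongrightarrow> W x * h' x"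
    proof (rule AE_I2)
      fix x
      have "((\<lambda>s. (1 / s) *\<^sub>R (h (x + s *\<^sub>R u) - h x)) \<longlongrightarrow> h' x) (at 0)"
      proof -
        have "((\<lambda>s. norm (h (x + s *\<^sub>R u) - h x - s *\<^sub>R h' x) / norm s) \<longlongrightarrow> 0) (at 0)"
          using der[of x] unfolding has_vector_derivative_def has_derivative_at by simp
        then have "((\<lambda>s. norm ((1 / s) *\<^sub>R (h (x + s *\<^sub>R u) - h x - s *\<^sub>R h' x))) \<longlongrightarrow> 0) (at 0)"
          by (simp del: scaleR_conv_of_real)
        then have "((\<lambda>s. (1 / s) *\<^sub>R (h (x + s *\<^sub>R u) - h x - s *\<^sub>R h' x)) \<longlongrightarrow> 0) (at 0)"
          by (rule tendsto_norm_zero_cancel)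
        then have "((\<lambda>s. (1 / s) *\<^sub>R (h (x + s *\<^sub>R u) - h x - s *\<^sub>R h' x) + h' x) \<longlongrightarrow> 0 + h' x) (at 0)"
          by (intro tendsto_intros)
        moreover have "eventually (\<lambda>s. (1 / s) *\<^sub>R (h (x + s *\<^sub>R u) - h x - s *\<^sub>R h' x) + h' x = (1 / s) *\<^sub>R (h (x + s *\<^sub>R u) - h x)) (at 0)"
          by (auto simp: eventually_at_filter scaleR_diff_right)
        ultimately show ?thesis by (simp add: tendsto_cong)
      qed
      moreover have "filterlim (\<lambda>n. 1 / real (Suc n)) (at 0) sequentially"
        unfolding filterlim_at using LIMSEQ_Suc[OF lim_1_over_n] by (auto intro!: eventuallyI)
      ultimately have "(\<lambda>n. (1 / (1 / real (Suc n))) *\<^sub>R (h (x + (1 / real (Suc n)) *\<^sub>R u) - h x)) \<longlonglongrightarrow> h' x"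
        by (rule filterlim_compose)
      then have "(\<lambda>n. D n x) \<longlonglongrightarrow> h' x"
        unfolding D_def by (simp add: scaleR_conv_of_real del: of_nat_Suc)
      then show "(\<lambda>n. W x * D n x) \<longlonglongrightarrow> W x * h' x" by (intro tendsto_intros)
    qed
    show "AE x in lborel. norm (W x * D n x) \<le> M * indicat_real (cball 0 (R + norm u)) x" for n
    proof (rule AE_I2)
      fix x
      have "norm (D n x) \<le> real (Suc n) * (M * \<bar>1 / real (Suc n)\<bar>)"
        unfolding D_def norm_mult norm_of_nat by (intro mult_left_mono lip) auto
      then have 1: "norm (D n x) \<le> M" by simp
      have 2: "D n x = 0" if "norm x > R + norm u"
      proof -
        have "norm x \<le> norm (x + (1 / real (Suc n)) *\<^sub>R u) + norm ((1 / real (Suc n)) *\<^sub>R u)"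
          using norm_triangle_ineq4[of "x + (1 / real (Suc n)) *\<^sub>R u" "(1 / real (Suc n)) *\<^sub>R u"] by simp
        moreover have "norm ((1 / real (Suc n)) *\<^sub>R u) \<le> norm u"
          by (simp add: divide_le_eq mult_le_cancel_left1)
        ultimately have "norm (x + (1 / real (Suc n)) *\<^sub>R u) > R" using that by linarith
        moreover have "norm x > R" using that norm_ge_zero[of u] by linarith
        ultimately show ?thesis unfolding D_def using supp by simp
      qed
      have "norm (W x * D n x) \<le> 1 * norm (D n x)"
        unfolding norm_mult by (intro mult_right_mono bW) auto
      then show "norm (W x * D n x) \<le> M * indicat_real (cball 0 (R + norm u)) x"
        using 1 2 by (cases "norm x > R + norm u") (auto simp: indicator_def)
    qed
  qed
  then show ?thesis using zero by (simp add: LIMSEQ_const_iff)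
qed

section \<open>Test functions\<close>

lemma test_function_continuous: "test_function g \<Longrightarrow> continuous_on UNIV g"
  unfolding test_function_def using C_diff.simps(1) by blast

lemma test_function_differentiable: "test_function g \<Longrightarrow> g differentiable (at x)"
  unfolding test_function_def using C_diff.simps(2)[of 0 g]
  by (metis UNIV_I differentiable_on_def C_diff.simps(2))

lemma test_function_bounded_support:
  assumes "test_function g"
  obtains R where "\<And>x. norm x > R \<Longrightarrow> g x = 0"
proof -
  have "bounded (closure {x. g x \<noteq> 0})"
    using assms by (simp add: test_function_def compact_imp_bounded)
  then obtain R where "\<And>x. x \<in> closure {x. g x \<noteq> 0} \<Longrightarrow> norm x \<le> R"
    by (auto simp: bounded_iff)
  then have "\<And>x. g x \<noteq> 0 \<Longrightarrow> norm x \<le> R"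
    by (metis (mono_tags) closure_subset mem_Collect_eq subsetD)
  then show thesis using that by (metis not_le)
qed

lemma has_vector_derivative_line:
  fixes g :: "'a::real_normed_vector \<Rightarrow> 'b::real_normed_vector"
  assumes "(g has_derivative g') (at x)"
  shows "((\<lambda>t. g (x + t *\<^sub>R u)) has_vector_derivative g' u) (at 0)"
proof -
  have "((\<lambda>t. x + t *\<^sub>R u) has_derivative (\<lambda>t. t *\<^sub>R u)) (at (0::real))"
    by (auto intro!: derivative_eq_intros)
  then have "((\<lambda>t. g (x + t *\<^sub>R u)) has_derivative (\<lambda>t. g' (t *\<^sub>R u))) (at 0)"
    using assms by (intro has_derivative_compose[of _ _ 0 UNIV g g']) auto
  then show ?thesis
    by (simp add: has_vector_derivative_def linear_scale[OF has_derivative_linear[OF assms]])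
qed

lemma partial_deriv_has_derivative:
  fixes g :: "real ^ 'd \<Rightarrow> 'b::real_normed_vector"
  assumes "(g has_derivative g') (at x)"
  shows "partial_deriv i g x = g' (axis i 1)"
  unfolding partial_deriv_def
  by (rule vector_derivative_at) (rule has_vector_derivative_line[OF assms])

lemma test_function_directional_derivative:
  fixes g :: "real ^ 'd \<Rightarrow> complex"
  assumes "test_function g"
  shows "((\<lambda>s. g (x + s *\<^sub>R u)) has_vector_derivative (\<Sum>i\<in>UNIV. u $ i *\<^sub>R partial_deriv i g x)) (at 0)"
proof -
  obtain g' where g': "(g has_derivative g') (at x)"
    using test_function_differentiable[OF assms] unfolding differentiable_def by blast
  have lin: "linear g'" using g' by (rule has_derivative_linear)
  have "g' u = g' (\<Sum>i\<in>UNIV. u $ i *\<^sub>R axis i 1)"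
    by (metis (no_types) basis_expansion scalar_mult_eq_scaleR sum.cong)
  also have "\<dots> = (\<Sum>i\<in>UNIV. u $ i *\<^sub>R partial_deriv i g x)"
    by (simp add: linear_sum[OF lin] linear_scale[OF lin] partial_deriv_has_derivative[OF g'])
  finally have gu: "g' u = (\<Sum>i\<in>UNIV. u $ i *\<^sub>R partial_deriv i g x)" .
  show ?thesis using has_vector_derivative_line[OF g', of u] gu by simp
qed

lemma test_function_partial_deriv:
  assumes "test_function g"
  shows "test_function (partial_deriv i g)"
  unfolding test_function_def
proof
  show "\<forall>k. C_diff k (partial_deriv i g)"
    using assms unfolding test_function_def by (metis C_diff.simps(2))
  have "{x. partial_deriv i g x \<noteq> 0} \<subseteq> closure {x. g x \<noteq> 0}"
  proof (intro subsetI, rule ccontr)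
    fix x assume x: "x \<in> {x. partial_deriv i g x \<noteq> 0}" "x \<notin> closure {x. g x \<noteq> 0}"
    then have "eventually (\<lambda>y. y \<in> - closure {x. g x \<noteq> 0}) (nhds x)"
      by (intro eventually_nhds_in_open) auto
    then have ev: "eventually (\<lambda>y. 0 = g y) (at x within UNIV)"
      unfolding eventually_at_filter
      by (rule eventually_mono) (use closure_subset in force)
    have "(g has_derivative (\<lambda>_. 0)) (at x)"
      by (rule has_derivative_transform_eventually[OF _ ev]) (use x(2) closure_subset in force)+
    from partial_deriv_has_derivative[OF this] x(1) show False by simp
  qed
  then have "closure {x. partial_deriv i g x \<noteq> 0} \<subseteq> closure {x. g x \<noteq> 0}"
    by (intro closure_minimal) auto
  then show "compact (closure {x. partial_deriv i g x \<noteq> 0})"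
    using compact_Int_closed[of "closure {x. g x \<noteq> 0}" "closure {x. partial_deriv i g x \<noteq> 0}"] assms
    by (simp add: test_function_def Int_absorb1)
qed

lemma C_diff_scaleR_plus:
  fixes f g :: "real ^ 'd \<Rightarrow> 'b::real_normed_vector"
  assumes "C_diff k f" "C_diff k g"
  shows "C_diff k (\<lambda>x. c *\<^sub>R f x + g x)"
  using assms
proof (induction k arbitrary: f g)
  case (Suc k)
  have df: "f differentiable (at x)" "g differentiable (at x)" for x
    using Suc.prems by (auto simp: differentiable_on_def)
  have "partial_deriv i (\<lambda>x. c *\<^sub>R f x + g x) =
      (\<lambda>x. c *\<^sub>R partial_deriv i f x + partial_deriv i g x)" for i
  proof
    fix x
    obtain f' g' where fg: "(f has_derivative f') (at x)" "(g has_derivative g') (at x)"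
      using df unfolding differentiable_def by blast
    then have "((\<lambda>x. c *\<^sub>R f x + g x) has_derivative (\<lambda>v. c *\<^sub>R f' v + g' v)) (at x)"
      by (auto intro!: derivative_eq_intros)
    then show "partial_deriv i (\<lambda>x. c *\<^sub>R f x + g x) x = c *\<^sub>R partial_deriv i f x + partial_deriv i g x"
      using fg by (simp add: partial_deriv_has_derivative)
  qed
  then show ?case
    using Suc by (auto intro!: derivative_intros)
qed (auto intro!: continuous_intros)

text \<open>The shape \<open>(a \<bullet> x) f + g\<close> is reproduced by every partial derivative, with new \<open>f\<close> and \<open>g\<close>;
this makes the induction on the order of differentiability close.\<close>

lemma C_diff_linear_times_plus:
  fixes f g :: "real ^ 'd \<Rightarrow> complex"
  assumes "\<And>k. C_diff k f" "\<And>k. C_diff k g"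
  shows "C_diff k (\<lambda>x. (a \<bullet> x) *\<^sub>R f x + g x)"
  using assms
proof (induction k arbitrary: f g)
  case 0
  have "continuous_on UNIV f" "continuous_on UNIV g"
    using 0[of 0] by simp_all
  then show ?case by (auto intro!: continuous_intros)
next
  case (Suc k)
  have df: "f differentiable (at x)" "g differentiable (at x)" for x
    using Suc.prems[of "Suc 0"] by (auto simp: differentiable_on_def)
  have der: "((\<lambda>x. (a \<bullet> x) *\<^sub>R f x + g x) has_derivative
        (\<lambda>v. (a \<bullet> x) *\<^sub>R f' v + (a \<bullet> v) *\<^sub>R f x + g' v)) (at x)"
    if "(f has_derivative f') (at x)" "(g has_derivative g') (at x)" for f' g' x
    using that by (auto intro!: derivative_eq_intros)
  have "(\<lambda>x. (a \<bullet> x) *\<^sub>R f x + g x) differentiable_on UNIV"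
    using df by (auto simp: differentiable_on_def intro!: derivative_intros)
  moreover have "partial_deriv i (\<lambda>x. (a \<bullet> x) *\<^sub>R f x + g x) =
      (\<lambda>x. (a \<bullet> x) *\<^sub>R partial_deriv i f x + ((a $ i) *\<^sub>R f x + partial_deriv i g x))" for i
  proof
    fix x
    obtain f' g' where fg: "(f has_derivative f') (at x)" "(g has_derivative g') (at x)"
      using df unfolding differentiable_def by blast
    show "partial_deriv i (\<lambda>x. (a \<bullet> x) *\<^sub>R f x + g x) x =
      (a \<bullet> x) *\<^sub>R partial_deriv i f x + ((a $ i) *\<^sub>R f x + partial_deriv i g x)"
      using partial_deriv_has_derivative[OF der[OF fg]] partial_deriv_has_derivative[OF fg(1)]
        partial_deriv_has_derivative[OF fg(2)] by (simp add: inner_axis)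
  qed
  moreover have "C_diff j (partial_deriv i f)" "C_diff j (partial_deriv i g)" for i j
    using Suc.prems[of "Suc j"] by auto
  then have "C_diff k (\<lambda>x. (a \<bullet> x) *\<^sub>R partial_deriv i f x + ((a $ i) *\<^sub>R f x + partial_deriv i g x))" for i
    by (intro Suc.IH C_diff_scaleR_plus Suc.prems)
  ultimately show ?case by simp
qed

lemma test_function_linear_times:
  fixes g :: "real ^ 'd \<Rightarrow> complex"
  assumes "test_function g"
  shows "test_function (\<lambda>x. of_real (a \<bullet> x) * g x)"
  unfolding test_function_def
proof
  have g: "C_diff k g" for k using assms by (simp add: test_function_def)
  have "C_diff k (\<lambda>x. (-1) *\<^sub>R g x + g x)" for k by (intro C_diff_scaleR_plus g)
  then have "C_diff k (\<lambda>x::real^'d. 0::complex)" for k by simp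
  then have "C_diff k (\<lambda>x. (a \<bullet> x) *\<^sub>R g x + 0)" for k
    by (intro C_diff_linear_times_plus g)
  then show "\<forall>k. C_diff k (\<lambda>x. of_real (a \<bullet> x) * g x)"
    unfolding scaleR_conv_of_real add_0_right by blast
  have "closure {x. of_real (a \<bullet> x) * g x \<noteq> 0} \<subseteq> closure {x. g x \<noteq> 0}"
    by (intro closure_mono) auto
  then show "compact (closure {x. of_real (a \<bullet> x) * g x \<noteq> 0})"
    using compact_Int_closed[of "closure {x. g x \<noteq> 0}" "closure {x. of_real (a \<bullet> x) * g x \<noteq> 0}"] assms
    by (simp add: test_function_def Int_absorb1 del: mult_eq_0_iff)
qed

section \<open>Primitives of quadratic phases\<close>

text \<open>The oscillation of \<open>exp (\<i> x\<^sup>2)\<close> makes its primitive bounded: one integration by parts writes it,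
for \<open>x \<ge> 1\<close>, as \<open>exp (\<i> x\<^sup>2) / (2 \<i> x)\<close> plus the integral of a function of size \<open>1 / (2 x\<^sup>2)\<close>.\<close>

lemma fresnel_primitive:
  obtains F :: "real \<Rightarrow> complex" and C :: real where
    "\<And>x. (F has_vector_derivative exp (\<i> * of_real (x\<^sup>2))) (at x)" "\<And>x. norm (F x) \<le> C"
proof -
  have "(\<lambda>z. exp (\<i> * z\<^sup>2)) holomorphic_on UNIV" by (intro holomorphic_intros)
  then obtain G where G: "\<And>z. (G has_field_derivative exp (\<i> * z\<^sup>2)) (at z)"
    using holomorphic_convex_primitive'[OF convex_UNIV open_UNIV] by auto
  define F where "F x = G (of_real x)" for x :: real
  have F: "(F has_vector_derivative exp (\<i> * of_real (x\<^sup>2))) (at x)" for x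
    using has_vector_derivative_real_field[OF G[of "of_real x"]] unfolding F_def by simp
  have cF: "continuous_on S F" for S
    using F by (intro continuous_at_imp_continuous_on ballI) (metis has_vector_derivative_continuous)
  have "compact (F ` {-1..1})" by (intro compact_continuous_image cF) auto
  then obtain M where M: "\<And>x. x \<in> {-1..1} \<Longrightarrow> norm (F x) \<le> M"
    by (metis compact_imp_bounded bounded_iff imageI)
  have pos: "norm (F x) \<le> M + 2" if "x \<ge> 1" for x
  proof (cases "x = 1")
    case False
    with that have x: "x > 1" by simp
    \<comment> \<open>Subtracting the boundary term of the integration by parts leaves an integrable derivative.\<close>
    define D where "D x = F x - exp (\<i> * of_real (x\<^sup>2)) / (2 * \<i> * of_real x)" for x
    have "norm (D x - D 1) \<le> (- (1 / (2 * x))) - (- (1 / (2 * 1)))"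
    proof (rule differentiable_bound_general[OF x])
      show "continuous_on {1..x} D"
        unfolding D_def by (intro continuous_intros cF) auto
      show "continuous_on {1..x} (\<lambda>x. - (1 / (2 * x)))" by (intro continuous_intros) auto
      fix t :: real assume t: "1 < t" "t < x"
      show "((\<lambda>x. - (1 / (2 * x))) has_vector_derivative 1 / (2 * t\<^sup>2)) (at t)"
        using t unfolding has_real_derivative_iff_has_vector_derivative[symmetric]
        by (auto intro!: derivative_eq_intros simp: power2_eq_square field_simps)
      have "((\<lambda>z. exp (\<i> * z\<^sup>2) / (2 * \<i> * z)) has_field_derivative
           exp (\<i> * (of_real t)\<^sup>2) - exp (\<i> * (of_real t)\<^sup>2) / (2 * \<i> * (of_real t)\<^sup>2)) (at (of_real t))"
        using t by (auto intro!: derivative_eq_intros simp: power2_eq_square field_simps)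
      from has_vector_derivative_real_field[OF this]
      have "((\<lambda>x. exp (\<i> * of_real (x\<^sup>2)) / (2 * \<i> * of_real x)) has_vector_derivative
           exp (\<i> * of_real (t\<^sup>2)) - exp (\<i> * of_real (t\<^sup>2)) / (2 * \<i> * (of_real t)\<^sup>2)) (at t)"
        by simp
      from has_vector_derivative_diff[OF F this]
      show "(D has_vector_derivative exp (\<i> * of_real (t\<^sup>2)) / (2 * \<i> * (of_real t)\<^sup>2)) (at t)"
        unfolding D_def by simp
      show "norm (exp (\<i> * of_real (t\<^sup>2)) / (2 * \<i> * (of_real t)\<^sup>2)) \<le> 1 / (2 * t\<^sup>2)"
        by (simp add: norm_divide norm_mult norm_power)
    qed
    moreover have "- (1 / (2 * x)) - (- (1 / (2 * 1))) \<le> 1 / 2" using x by simp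
    ultimately have "norm (D x - D 1) \<le> 1 / 2" by linarith
    moreover have "norm (exp (\<i> * of_real (x\<^sup>2)) / (2 * \<i> * of_real x)) \<le> 1 / 2" "norm (exp (\<i> * of_real (1\<^sup>2)) / (2 * \<i> * of_real 1)) \<le> 1 / 2"
      using x by (auto simp: norm_divide norm_mult)
    moreover have "norm (F 1) \<le> M" using M by simp
    moreover have "norm (F x) \<le> norm (D x - D 1) + norm (exp (\<i> * of_real (x\<^sup>2)) / (2 * \<i> * of_real x))
        + norm (exp (\<i> * of_real (1\<^sup>2)) / (2 * \<i> * of_real 1)) + norm (F 1)"
    proof -
      have *: "F x = (D x - D 1) + exp (\<i> * of_real (x\<^sup>2)) / (2 * \<i> * of_real x) - exp (\<i> * of_real (1\<^sup>2)) / (2 * \<i> * of_real 1) + F 1"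
        unfolding D_def by simp
      show ?thesis
        by (subst *) (intro norm_triangle_le norm_triangle_le_diff add_mono order_refl)
    qed
    ultimately show ?thesis by linarith
  qed (use M[of 1] in simp)
  have odd: "F (-x) = 2 * F 0 - F x" for x
  proof -
    have "((\<lambda>x. F x + F (-x)) has_vector_derivative 0) (at x)" for x
    proof -
      have "((\<lambda>x. F (-x)) has_vector_derivative (-1) *\<^sub>R exp (\<i> * of_real (x\<^sup>2))) (at x)"
      proof -
        have "(uminus has_vector_derivative -1) (at x)"
          by (auto intro!: derivative_eq_intros)
        from vector_diff_chain_at[OF this F[of "-x"]] show ?thesis by (simp add: o_def)
      qed
      from has_vector_derivative_add[OF F this] show ?thesis by simp
    qed
    then obtain c where c: "\<And>x. F x + F (-x) = c"
      using has_vector_derivative_zero_constant[of UNIV "\<lambda>x. F x + F (-x)"]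
      by (metis UNIV_I convex_UNIV)
    from c[of 0] c[of x] show ?thesis by (simp add: algebra_simps)
  qed
  have "norm (F x) \<le> 3 * (M + 2)" for x
  proof -
    have M0: "M \<ge> 0" using order_trans[OF norm_ge_zero M[of 0]] by simp
    consider "x \<in> {-1..1}" | "x \<ge> 1" | "-x \<ge> 1" by force
    then show ?thesis
    proof cases
      case 3
      have "F x = 2 * F 0 - F (-x)" using odd[of "-x"] by simp
      then have "norm (F x) \<le> 2 * norm (F 0) + norm (F (-x))"
        by (metis norm_triangle_ineq4 norm_mult norm_numeral)
      then show ?thesis using M[of 0] pos[OF 3] M0 by simp
    qed (use M[of x] pos[of x] M0 in auto)
  qed
  with F that show thesis by blast
qed

text \<open>Completing the square and rescaling reduces every quadratic phase to the Fresnel integral; the scaling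
produces the factor \<open>\<bar>\<mu>\<bar> powr (-1/2)\<close>, and the constant depends neither on \<open>y\<close> nor on \<open>\<mu>\<close>.\<close>

lemma quadratic_phase_primitive:
  obtains C :: real where "C > 0"
    "\<And>y \<mu>. \<mu> \<noteq> 0 \<Longrightarrow> \<exists>K. (\<forall>s. (K has_vector_derivative exp (\<i> * of_real (y * s + \<mu> * s\<^sup>2))) (at s))
        \<and> (\<forall>s. norm (K s) \<le> C / sqrt \<bar>\<mu>\<bar>)"
proof -
  obtain F :: "real \<Rightarrow> complex" and C :: real where
    F: "\<And>x. (F has_vector_derivative exp (\<i> * of_real (x\<^sup>2))) (at x)" and C: "\<And>x. norm (F x) \<le> C"
    by (rule fresnel_primitive) blast
  have pos: "\<exists>K. (\<forall>s. (K has_vector_derivative exp (\<i> * of_real (y * s + \<mu> * s\<^sup>2))) (at s))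
        \<and> (\<forall>s. norm (K s) \<le> (C + 1) / sqrt \<bar>\<mu>\<bar>)" if "\<mu> > 0" for y \<mu> :: real
  proof (intro exI conjI allI)
    define r where "r = sqrt \<mu>"
    have r: "r > 0" "\<mu> = r\<^sup>2" using that by (auto simp: r_def)
    define c where "c = exp (- \<i> * of_real ((y / (2 * r))\<^sup>2)) / of_real r"
    let ?K = "\<lambda>s. c * F (r * s + y / (2 * r))"
    fix s :: real
    have "((\<lambda>s. F (r * s + y / (2 * r))) has_vector_derivative r *\<^sub>R exp (\<i> * of_real ((r * s + y / (2 * r))\<^sup>2))) (at s)"
      using vector_diff_chain_at[of "\<lambda>s. r * s + y / (2 * r)" r s F] F
      by (force intro!: derivative_eq_intros simp: o_def)
    then have "(?K has_vector_derivative c * (r *\<^sub>R exp (\<i> * of_real ((r * s + y / (2 * r))\<^sup>2)))) (at s)"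
      by (rule has_vector_derivative_mult_right)
    also have "c * (r *\<^sub>R exp (\<i> * of_real ((r * s + y / (2 * r))\<^sup>2))) =
       exp (- \<i> * of_real ((y / (2 * r))\<^sup>2)) * exp (\<i> * of_real ((r * s + y / (2 * r))\<^sup>2))"
      using r by (simp add: c_def scaleR_conv_of_real)
    also have "\<dots> = exp (\<i> * of_real (- ((y / (2 * r))\<^sup>2) + (r * s + y / (2 * r))\<^sup>2))"
      by (simp add: exp_add[symmetric] algebra_simps)
    also have "- ((y / (2 * r))\<^sup>2) + (r * s + y / (2 * r))\<^sup>2 = y * s + \<mu> * s\<^sup>2"
      using r by (simp add: power2_eq_square field_simps)
    finally show "(?K has_vector_derivative exp (\<i> * of_real (y * s + \<mu> * s\<^sup>2))) (at s)" .
    have "norm c = 1 / r" using r by (simp add: c_def norm_divide norm_exp_eq_Re)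
    then have "norm (?K s) \<le> (1 / r) * (C + 1)"
      unfolding norm_mult using C[of "r * s + y / (2 * r)"] r by (intro mult_mono) auto
    then show "norm (?K s) \<le> (C + 1) / sqrt \<bar>\<mu>\<bar>" using r by simp
  qed
  show thesis
  proof (rule that)
    show "C + 1 > 0" using C[of 0] norm_ge_zero[of "F 0"] by linarith
    fix y \<mu> :: real assume "\<mu> \<noteq> 0"
    then consider "\<mu> > 0" | "- \<mu> > 0" by linarith
    then show "\<exists>K. (\<forall>s. (K has_vector_derivative exp (\<i> * of_real (y * s + \<mu> * s\<^sup>2))) (at s))
        \<and> (\<forall>s. norm (K s) \<le> (C + 1) / sqrt \<bar>\<mu>\<bar>)"
    proof cases
      case 2
      from pos[OF this, of "-y"] obtain K where
        K: "\<And>s. (K has_vector_derivative exp (\<i> * of_real (- y * s + (- \<mu>) * s\<^sup>2))) (at s)"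
           "\<And>s. norm (K s) \<le> (C + 1) / sqrt \<bar>- \<mu>\<bar>" by blast
      have "((\<lambda>s. cnj (K s)) has_vector_derivative exp (\<i> * of_real (y * s + \<mu> * s\<^sup>2))) (at s)" for s
        using has_vector_derivative_cnj[OF K(1)[of s]] by (simp add: exp_cnj algebra_simps)
      with K(2) show ?thesis by (intro exI[of _ "\<lambda>s. cnj (K s)"]) auto
    qed (use pos in blast)
  qed
qed

section \<open>Repeated integration by parts in orthogonal directions\<close>

text \<open>The data of an oscillatory integral whose oscillation splits into one-dimensional factors \<open>E j\<close> along
orthonormal directions \<open>u j\<close>, each with a primitive \<open>K j\<close> of size at most \<open>B j\<close>, times a remaining factor
\<open>W\<close> that is constant along all these directions.\<close>

definition oscillatory_factors ::
  "'k set \<Rightarrow> ('k \<Rightarrow> real ^ 'd) \<Rightarrow> ('k \<Rightarrow> real \<Rightarrow> complex) \<Rightarrow> ('k \<Rightarrow> real \<Rightarrow> complex)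
    \<Rightarrow> ('k \<Rightarrow> real) \<Rightarrow> (real ^ 'd \<Rightarrow> complex) \<Rightarrow> bool" where
  "oscillatory_factors S u K E B W \<longleftrightarrow>
      (\<forall>j\<in>S. norm (u j) = 1) \<and> (\<forall>i\<in>S. \<forall>j\<in>S. i \<noteq> j \<longrightarrow> u i \<bullet> u j = 0) \<and>
      (\<forall>j\<in>S. \<forall>s. (K j has_vector_derivative E j s) (at s)) \<and>
      (\<forall>j\<in>S. continuous_on UNIV (E j)) \<and> (\<forall>j\<in>S. \<forall>s. norm (E j s) \<le> 1) \<and>
      (\<forall>j\<in>S. B j > 0) \<and> (\<forall>j\<in>S. \<forall>s. norm (K j s) \<le> B j) \<and>
      continuous_on UNIV W \<and> (\<forall>x. norm (W x) \<le> 1) \<and> (\<forall>j\<in>S. \<forall>x s. W (x + s *\<^sub>R u j) = W x)"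

text \<open>Each direction in \<open>S\<close> is integrated by parts once, which replaces the oscillating factor by its primitive
and hence gains \<open>B j\<close>; the derivative falls on the amplitude only. The directional derivative of the
amplitude is expanded into partial derivatives, so that the constant depends on \<open>g\<close> and \<open>S\<close> but not on the
directions; after use the bounded primitive is moved into the weight \<open>W\<close>.\<close>

lemma oscillatory_integral_multi_parts:
  fixes S :: "'k set"
  assumes "finite S"
  shows "test_function (g :: real ^ 'd \<Rightarrow> complex) \<Longrightarrow>
    \<exists>C\<ge>0. \<forall>u K E B W.
      oscillatory_factors S u K E B W \<longrightarrow>
      norm (LINT x|lborel. W x * (\<Prod>j\<in>S. E j (u j \<bullet> x)) * g x) \<le> C * (\<Prod>j\<in>S. B j)"
  using assms
proof (induction S arbitrary: g rule: finite_induct)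
  case empty
  obtain R where R: "\<And>x. norm x > R \<Longrightarrow> g x = 0" using test_function_bounded_support[OF empty] by blast
  have ig: "integrable lborel g"
    by (rule integrable_continuous_bounded_support[OF test_function_continuous[OF empty] R])
  show ?case
  proof (intro exI conjI allI impI)
    show "0 \<le> (LINT x|lborel. norm (g x))" by simp
    fix W :: "real ^ 'd \<Rightarrow> complex" and B :: "'k \<Rightarrow> real" and u :: "'k \<Rightarrow> real ^ 'd"
      and E :: "'k \<Rightarrow> real \<Rightarrow> complex"
      and K :: "'k \<Rightarrow> real \<Rightarrow> complex"
    assume "oscillatory_factors {} u K E B W"
    then have W: "continuous_on UNIV W" "\<forall>x. norm (W x) \<le> 1" by (auto simp: oscillatory_factors_def)
    have [measurable]: "W \<in> borel_measurable borel" "g \<in> borel_measurable borel"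
      using W(1) test_function_continuous[OF empty] by (auto intro: borel_measurable_continuous_onI)
    have le: "norm (W x * g x) \<le> norm (g x)" for x
      using W(2) by (simp add: norm_mult mult_left_le_one_le)
    have "integrable lborel (\<lambda>x. W x * g x)"
      by (rule Bochner_Integration.integrable_bound[OF ig]) (use le in auto)
    then have "norm (LINT x|lborel. W x * g x) \<le> (LINT x|lborel. norm (g x))"
      using le ig by (intro order_trans[OF integral_norm_bound] integral_mono) auto
    then show "norm (LINT x|lborel. W x * (\<Prod>j\<in>{}. E j (u j \<bullet> x)) * g x)
      \<le> (LINT x|lborel. norm (g x)) * (\<Prod>j\<in>{}. B j)" by simp
  qed
next
  case (insert k S)
  let ?d = "\<lambda>i. partial_deriv i g"
  have "\<forall>i. \<exists>C\<ge>0. \<forall>u K E B W.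
      oscillatory_factors S u K E B W \<longrightarrow>
      norm (LINT x|lborel. W x * (\<Prod>j\<in>S. E j (u j \<bullet> x)) * ?d i x) \<le> C * (\<Prod>j\<in>S. B j)"
    by (intro allI insert.IH test_function_partial_deriv insert.prems)
  then obtain c where c0: "\<And>i. c i \<ge> 0" and c: "\<And>i u K E B W.
      oscillatory_factors S u K E B W \<Longrightarrow>
      norm (LINT x|lborel. W x * (\<Prod>j\<in>S. E j (u j \<bullet> x)) * ?d i x) \<le> c i * (\<Prod>j\<in>S. B j)"
    unfolding choice_iff by (elim exE) blast
  obtain R where R: "\<And>x. norm x > R \<Longrightarrow> g x = 0"
    using test_function_bounded_support[OF insert.prems] by blast
  have cg: "continuous_on UNIV g" "continuous_on UNIV (?d i)" for i
    using insert.prems by (auto intro: test_function_continuous test_function_partial_deriv)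
  show ?case
  proof (intro exI[of _ "\<Sum>i\<in>UNIV. c i"] conjI allI impI)
    show "0 \<le> (\<Sum>i\<in>UNIV. c i)" using c0 by (simp add: sum_nonneg)
    fix u :: "'k \<Rightarrow> real ^ 'd" and K E :: "'k \<Rightarrow> real \<Rightarrow> complex" and B :: "'k \<Rightarrow> real"
      and W :: "real ^ 'd \<Rightarrow> complex"
    assume "oscillatory_factors (insert k S) u K E B W"
    then have u: "\<forall>j\<in>insert k S. norm (u j) = 1" "\<forall>i\<in>insert k S. \<forall>j\<in>insert k S. i \<noteq> j \<longrightarrow> u i \<bullet> u j = 0"
      and K: "\<forall>j\<in>insert k S. \<forall>s. (K j has_vector_derivative E j s) (at s)"
      and E: "\<forall>j\<in>insert k S. continuous_on UNIV (E j)" "\<forall>j\<in>insert k S. \<forall>s. norm (E j s) \<le> 1"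
      and B: "\<forall>j\<in>insert k S. B j > 0" and KB: "\<forall>j\<in>insert k S. \<forall>s. norm (K j s) \<le> B j"
      and W: "continuous_on UNIV W" "\<forall>x. norm (W x) \<le> 1" "\<forall>j\<in>insert k S. \<forall>x s. W (x + s *\<^sub>R u j) = W x"
      unfolding oscillatory_factors_def by - (elim conjE, assumption)+
    have uk: "u j \<bullet> u k = 0" if "j \<in> S" for j
      using u(2) that insert.hyps(2) by auto
    have uu: "u k \<bullet> u k = 1" using u(1) by (simp add: dot_square_norm)
    have cK: "continuous_on UNIV (K k)"
    proof (intro continuous_at_imp_continuous_on ballI)
      fix s
      have "(K k has_vector_derivative E k s) (at s)" using K by blast
      then show "isCont (K k) s" by (rule has_vector_derivative_continuous)
    qed
    define V where "V x = W x * (\<Prod>j\<in>S. E j (u j \<bullet> x))" for x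
    define D where "D x = (\<Sum>i\<in>UNIV. u k $ i *\<^sub>R ?d i x)" for x
    have cE: "continuous_on UNIV (\<lambda>x. E j (u j \<bullet> x))" if "j \<in> insert k S" for j
    proof -
      have "continuous_on UNIV (E j)" using E(1) that by blast
      then show ?thesis by (rule continuous_on_compose2) (auto intro!: continuous_intros)
    qed
    have cKu: "continuous_on UNIV (\<lambda>x. K k (u k \<bullet> x))"
      by (intro continuous_on_compose2[OF cK]) (auto intro!: continuous_intros)
    have cV: "continuous_on UNIV V"
      unfolding V_def using W cE by (intro continuous_intros) auto
    have bV: "norm (V x) \<le> 1" for x
    proof -
      have "(\<Prod>j\<in>S. norm (E j (u j \<bullet> x))) \<le> 1" by (intro prod_le_1) (use E(2) in simp)
      then show ?thesis unfolding V_def norm_mult prod_norm[symmetric]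
        using W(2) by (intro mult_le_one prod_nonneg) auto
    qed
    have iV: "V (x + s *\<^sub>R u k) = V x" for x s
      unfolding V_def using W(3) uk by (simp add: inner_add_right)
    have cD: "continuous_on UNIV D" unfolding D_def by (intro continuous_intros cg)
    have key: "(LINT x|lborel. V x * (D x * K k (u k \<bullet> x) + g x * E k (u k \<bullet> x))) = 0"
    proof (rule integral_directional_derivative_eq_0[where h = "\<lambda>x. g x * K k (u k \<bullet> x)" and R = R and u = "u k"])
      show "continuous_on UNIV (\<lambda>x. g x * K k (u k \<bullet> x))" by (intro continuous_intros cg cKu)
      show "continuous_on UNIV (\<lambda>x. D x * K k (u k \<bullet> x) + g x * E k (u k \<bullet> x))"
        by (intro continuous_intros cg cKu cD cE) auto
      show "((\<lambda>s. g (x + s *\<^sub>R u k) * K k (u k \<bullet> (x + s *\<^sub>R u k))) has_vector_derivative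
             D x * K k (u k \<bullet> x) + g x * E k (u k \<bullet> x)) (at 0)" for x
      proof -
        have 1: "((\<lambda>s. g (x + s *\<^sub>R u k)) has_vector_derivative D x) (at 0)"
          unfolding D_def by (rule test_function_directional_derivative[OF insert.prems])
        have "((\<lambda>s. u k \<bullet> x + s) has_vector_derivative 1) (at 0)"
          by (auto intro!: derivative_eq_intros)
        from vector_diff_chain_at[OF this, of "K k" "E k (u k \<bullet> x)"] K
        have "((\<lambda>s. K k (u k \<bullet> (x + s *\<^sub>R u k))) has_vector_derivative E k (u k \<bullet> x)) (at 0)"
          by (simp add: o_def inner_add_right uu)
        from has_vector_derivative_mult[OF 1 this] show ?thesis by (simp add: add.commute)
      qed
      show "g x * K k (u k \<bullet> x) = 0" if "R < norm x" for x using R[OF that] by simp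
    qed (use cV bV iV in auto)
    have supp_d: "\<exists>R. \<forall>x. norm x > R \<longrightarrow> ?d i x = 0" for i
      using test_function_bounded_support[OF test_function_partial_deriv[OF insert.prems]] by metis
    have int_d: "integrable lborel (\<lambda>x. V x * K k (u k \<bullet> x) * ?d i x)" for i
    proof -
      obtain R' where "\<And>x. norm x > R' \<Longrightarrow> ?d i x = 0" using supp_d by blast
      then show ?thesis
        by (intro integrable_continuous_bounded_support[where R = R'] continuous_intros cV cKu cg) auto
    qed
    have int_g: "integrable lborel (\<lambda>x. V x * (g x * E k (u k \<bullet> x)))"
      by (rule integrable_continuous_bounded_support[where R = R])
         (use R in \<open>auto intro!: continuous_intros cV cE cg\<close>)
    have VD: "V x * (D x * K k (u k \<bullet> x)) = (\<Sum>i\<in>UNIV. of_real (u k $ i) * (V x * K k (u k \<bullet> x) * ?d i x))" for x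
      unfolding D_def by (simp add: sum_distrib_left sum_distrib_right scaleR_conv_of_real mult_ac)
    have int_D: "integrable lborel (\<lambda>x. V x * (D x * K k (u k \<bullet> x)))"
      unfolding VD by (intro Bochner_Integration.integrable_sum integrable_mult_right int_d)
    have "(LINT x|lborel. V x * (D x * K k (u k \<bullet> x))) + (LINT x|lborel. V x * (g x * E k (u k \<bullet> x))) = 0"
      using key by (simp add: distrib_left Bochner_Integration.integral_add[OF int_D int_g])
    then have eq: "(LINT x|lborel. V x * (g x * E k (u k \<bullet> x))) = - (LINT x|lborel. V x * (D x * K k (u k \<bullet> x)))"
      by (simp add: add_eq_0_iff2)
    have part: "norm (LINT x|lborel. V x * K k (u k \<bullet> x) * ?d i x) \<le> B k * (c i * (\<Prod>j\<in>S. B j))" for i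
    proof -
      \<comment> \<open>The primitive, normalised to be bounded by 1, becomes part of the weight for the other directions.\<close>
      define W' where "W' x = W x * (K k (u k \<bullet> x) / of_real (B k))" for x
      have Bk: "B k > 0" using B by simp
      have "norm (LINT x|lborel. W' x * (\<Prod>j\<in>S. E j (u j \<bullet> x)) * ?d i x) \<le> c i * (\<Prod>j\<in>S. B j)"
      proof (rule c)
        have "continuous_on UNIV W'" unfolding W'_def using Bk by (intro continuous_intros W cKu) auto
        moreover have "\<forall>x. norm (W' x) \<le> 1"
          unfolding W'_def norm_mult norm_divide using W(2) KB Bk by (intro allI mult_le_one) auto
        moreover have "\<forall>j\<in>S. \<forall>x s. W' (x + s *\<^sub>R u j) = W' x"
          unfolding W'_def using W(3) uk by (simp add: inner_add_right inner_commute)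
        ultimately show "oscillatory_factors S u K E B W'"
          unfolding oscillatory_factors_def using u K E B KB by auto
      qed
      moreover have "(LINT x|lborel. V x * K k (u k \<bullet> x) * ?d i x)
         = (LINT x|lborel. of_real (B k) * (W' x * (\<Prod>j\<in>S. E j (u j \<bullet> x)) * ?d i x))"
        unfolding V_def W'_def using Bk by (intro Bochner_Integration.integral_cong) (auto simp: field_simps)
      ultimately show ?thesis using Bk by (simp add: norm_mult mult_left_mono)
    qed
    have "norm (LINT x|lborel. V x * (D x * K k (u k \<bullet> x)))
       = norm (\<Sum>i\<in>UNIV. of_real (u k $ i) * (LINT x|lborel. V x * K k (u k \<bullet> x) * ?d i x))"
      unfolding VD using int_d by (subst Bochner_Integration.integral_sum) auto
    also have "\<dots> \<le> (\<Sum>i\<in>UNIV. 1 * (B k * (c i * (\<Prod>j\<in>S. B j))))"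
    proof (intro sum_norm_le)
      fix i
      have "\<bar>u k $ i\<bar> \<le> 1" using component_le_norm_cart[of "u k" i] u(1) by simp
      then show "norm (of_real (u k $ i) * (LINT x|lborel. V x * K k (u k \<bullet> x) * ?d i x)) \<le> 1 * (B k * (c i * (\<Prod>j\<in>S. B j)))"
        unfolding norm_mult using part by (intro mult_mono) auto
    qed
    also have "\<dots> = (\<Sum>i\<in>UNIV. c i) * (\<Prod>j\<in>insert k S. B j)"
      using insert.hyps by (simp add: sum_distrib_left sum_distrib_right mult_ac)
    finally have "norm (LINT x|lborel. V x * (g x * E k (u k \<bullet> x))) \<le> (\<Sum>i\<in>UNIV. c i) * (\<Prod>j\<in>insert k S. B j)"
      unfolding eq by simp
    moreover have "(\<lambda>x. V x * (g x * E k (u k \<bullet> x))) = (\<lambda>x. W x * (\<Prod>j\<in>insert k S. E j (u j \<bullet> x)) * g x)"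
      unfolding V_def using insert.hyps by (simp add: fun_eq_iff mult_ac)
    ultimately show "norm (LINT x|lborel. W x * (\<Prod>j\<in>insert k S. E j (u j \<bullet> x)) * g x)
        \<le> (\<Sum>i\<in>UNIV. c i) * (\<Prod>j\<in>insert k S. B j)" by simp
  qed
qed

section \<open>The spectral theorem for symmetric matrices\<close>

lemma symmetric_matrix_inner:
  fixes A :: "real ^ 'n ^ 'n"
  assumes "transpose A = A"
  shows "x \<bullet> (A *v y) = (A *v x) \<bullet> y"
  by (metis assms dot_lmul_matrix vector_transpose_matrix)

text \<open>A maximiser \<open>u\<close> of the Rayleigh quotient over the unit sphere of the subspace is an eigenvector: otherwise
moving it towards \<open>w = A u - l u\<close> would increase the quotient to first order.\<close>

lemma symmetric_eigenvector_in_invariant_subspace: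
  fixes A :: "real ^ 'n ^ 'n"
  assumes sym: "transpose A = A" and V: "subspace V" "\<And>v. v \<in> V \<Longrightarrow> A *v v \<in> V" and ne: "V \<noteq> {0}"
  obtains u l where "u \<in> V" "norm u = 1" "A *v u = l *\<^sub>R u"
proof -
  obtain v where v: "v \<in> V" "v \<noteq> 0" using ne V(1) subspace_0 by blast
  let ?S = "V \<inter> sphere 0 1"
  have "v /\<^sub>R norm v \<in> ?S" using v V(1) by (auto intro: subspace_scale)
  then have "?S \<noteq> {}" by blast
  moreover have "compact ?S" by (intro closed_Int_compact closed_subspace V) auto
  moreover have "continuous_on ?S (\<lambda>x. x \<bullet> (A *v x))"
    by (intro continuous_intros linear_continuous_on matrix_vector_mul_bounded_linear)
  ultimately obtain u where u: "u \<in> ?S" and max: "\<And>x. x \<in> ?S \<Longrightarrow> x \<bullet> (A *v x) \<le> u \<bullet> (A *v u)"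
    using continuous_attains_sup[of ?S "\<lambda>x. x \<bullet> (A *v x)"] by blast
  define l where "l = u \<bullet> (A *v u)"
  have u1: "u \<in> V" "norm u = 1" "u \<bullet> u = 1" using u by (auto simp: dot_square_norm)
  have homog: "x \<bullet> (A *v x) \<le> l * (x \<bullet> x)" if "x \<in> V" for x
  proof (cases "x = 0")
    case False
    have "x /\<^sub>R norm x \<in> ?S" using False that V(1) by (auto intro: subspace_scale)
    from max[OF this] have "(x \<bullet> (A *v x)) / (norm x)\<^sup>2 \<le> l"
      using False by (simp add: l_def matrix_vector_mult_scaleR power2_eq_square divide_inverse mult_ac)
    then show ?thesis using False by (simp add: divide_le_eq dot_square_norm mult_ac)
  qed simp
  define w where "w = A *v u - l *\<^sub>R u"
  have w: "w \<in> V" unfolding w_def using V u1 by (intro subspace_diff subspace_scale) auto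
  have uw: "u \<bullet> w = 0" unfolding w_def using u1 by (simp add: inner_diff_right l_def)
  have wAu: "w \<bullet> (A *v u) = w \<bullet> w"
    using uw unfolding w_def by (simp add: inner_diff_right inner_diff_left inner_commute)
  have "w \<bullet> w = 0"
  proof (rule ccontr)
    assume "w \<bullet> w \<noteq> 0"
    then have p: "w \<bullet> w > 0" by simp
    have quad: "2 * s * (w \<bullet> w) \<le> s\<^sup>2 * c" if "c = l * (w \<bullet> w) - w \<bullet> (A *v w)" for s c
    proof -
      have "(u + s *\<^sub>R w) \<bullet> (A *v (u + s *\<^sub>R w)) \<le> l * ((u + s *\<^sub>R w) \<bullet> (u + s *\<^sub>R w))"
        using u1 w V by (intro homog subspace_add subspace_scale) auto
      moreover have "u \<bullet> (A *v w) = w \<bullet> w"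
        using symmetric_matrix_inner[OF sym, of u w] wAu by (simp add: inner_commute)
      moreover have "w \<bullet> u = 0" using uw by (simp add: inner_commute)
      ultimately show ?thesis unfolding that using u1 uw wAu
        by (simp add: inner_add_left inner_add_right matrix_vector_right_distrib matrix_vector_mult_scaleR
            l_def[symmetric] power2_eq_square algebra_simps)
    qed
    define c where "c = l * (w \<bullet> w) - w \<bullet> (A *v w)"
    have "2 * (w \<bullet> w) \<le> s * c" if "s > 0" for s
      using quad[OF c_def, of s] that by (simp add: power2_eq_square mult_ac)
    \<comment> \<open>A step short enough for the quadratic term to be at most half of the linear one.\<close>
    from this[of "(w \<bullet> w) / (\<bar>c\<bar> + 1)"] p
    have "2 * (w \<bullet> w) \<le> (w \<bullet> w) * (c / (\<bar>c\<bar> + 1))" by simp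
    also have "\<dots> \<le> (w \<bullet> w) * 1" using p by (intro mult_left_mono) (auto simp: divide_le_eq)
    finally show False using p by simp
  qed
  then have "A *v u = l *\<^sub>R u" by (simp add: w_def)
  with u1 that show thesis by blast
qed

text \<open>Induction on the dimension: by symmetry, the orthogonal complement of an eigenvector in an invariant subspace
is invariant again.\<close>

lemma symmetric_eigenbasis_subspace:
  fixes A :: "real ^ 'n ^ 'n"
  assumes sym: "transpose A = A"
  shows "subspace V \<Longrightarrow> (\<And>v. v \<in> V \<Longrightarrow> A *v v \<in> V) \<Longrightarrow> dim V = k \<Longrightarrow>
    \<exists>B. finite B \<and> card B = k \<and> B \<subseteq> V \<and> pairwise orthogonal B \<and>
      (\<forall>b\<in>B. norm b = 1 \<and> (\<exists>l. A *v b = l *\<^sub>R b))"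
proof (induction k arbitrary: V)
  case 0
  show ?case by (rule exI[of _ "{}"]) (auto simp: pairwise_def)
next
  case (Suc k)
  from Suc.prems(3) have "V \<noteq> {0}" by auto
  from symmetric_eigenvector_in_invariant_subspace[OF sym Suc.prems(1,2) this]
  obtain u l where u: "u \<in> V" "norm u = 1" "A *v u = l *\<^sub>R u" by metis
  let ?V = "{v \<in> V. u \<bullet> v = 0}"
  have sub: "subspace ?V" using Suc.prems(1)
    by (auto simp: subspace_def inner_add_right)
  have span: "V = span (insert u ?V)"
  proof
    show "span (insert u ?V) \<subseteq> V" using Suc.prems(1) u by (intro span_minimal) auto
    show "V \<subseteq> span (insert u ?V)"
    proof
      fix v assume v: "v \<in> V"
      have "v - (u \<bullet> v) *\<^sub>R u \<in> ?V" using v u Suc.prems(1)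
        by (auto intro!: subspace_diff subspace_scale simp: inner_diff_right dot_square_norm)
      then have "(v - (u \<bullet> v) *\<^sub>R u) + (u \<bullet> v) *\<^sub>R u \<in> span (insert u ?V)"
        by (intro span_add span_scale span_base) auto
      then show "v \<in> span (insert u ?V)" by simp
    qed
  qed
  have "u \<notin> span ?V" using sub u by (auto simp: span_eq_iff[THEN iffD2] dot_square_norm)
  then have "dim (insert u ?V) = dim ?V + 1" by (simp add: dim_insert)
  moreover have "dim (insert u ?V) = dim V" using span by (metis dim_span)
  ultimately have "dim ?V = k" using Suc.prems(3) by simp
  moreover have "A *v v \<in> ?V" if "v \<in> ?V" for v
    using that Suc.prems(2) symmetric_matrix_inner[OF sym, of u v] u(3) by auto
  ultimately obtain B where B: "finite B" "card B = k" "B \<subseteq> ?V" "pairwise orthogonal B"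
      "\<forall>b\<in>B. norm b = 1 \<and> (\<exists>l. A *v b = l *\<^sub>R b)"
    using Suc.IH[OF sub] by blast
  have "u \<notin> B" using B(3) u by (auto simp: dot_square_norm)
  show ?case
  proof (intro exI[of _ "insert u B"] conjI)
    show "pairwise orthogonal (insert u B)"
      using B(3,4) by (auto simp: pairwise_insert orthogonal_def inner_commute)
  qed (use B u \<open>u \<notin> B\<close> in auto)
qed

theorem symmetric_orthonormal_eigenbasis:
  fixes A :: "real ^ 'n ^ 'n"
  assumes "transpose A = A"
  obtains u :: "'n \<Rightarrow> real ^ 'n" and l where
    "\<And>i j. u i \<bullet> u j = (if i = j then 1 else 0)" "\<And>i. A *v u i = l i *\<^sub>R u i"
proof -
  obtain B where B: "finite B" "card B = CARD('n)" "pairwise orthogonal B"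
      "\<forall>b\<in>B. norm b = 1 \<and> (\<exists>l. A *v b = l *\<^sub>R b)"
    using symmetric_eigenbasis_subspace[OF assms subspace_UNIV, of "CARD('n)"] by auto
  then obtain u where u: "bij_betw u (UNIV :: 'n set) B"
    using finite_same_card_bij[of "UNIV :: 'n set" B] by auto
  then have uB: "u i \<in> B" for i by (auto simp: bij_betw_def)
  then have "\<forall>i. \<exists>l. A *v u i = l *\<^sub>R u i" using B(4) by blast
  then obtain l where "\<And>i. A *v u i = l i *\<^sub>R u i" by metis
  moreover have "u i \<bullet> u j = (if i = j then 1 else 0)" for i j
  proof (cases "i = j")
    case True
    then show ?thesis using B(4) uB by (simp add: dot_square_norm)
  next
    case False
    then have "u i \<noteq> u j" using u by (auto simp: bij_betw_def inj_on_def)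
    then show ?thesis using B(3) uB False by (auto simp: pairwise_def orthogonal_def)
  qed
  ultimately show thesis using that by blast
qed

section \<open>Pencils of quadratic forms and their minimal rank\<close>

lemma orthonormal_matrix:
  fixes u :: "'d \<Rightarrow> real ^ 'd"
  assumes "\<And>i j. u i \<bullet> u j = (if i = j then 1 else 0)"
  defines "M \<equiv> (\<chi> r c. u c $ r)"
  shows "\<And>i. column i M = u i" "transpose M ** M = mat 1" "M ** transpose M = mat 1" "invertible M"
proof -
  show col: "column i M = u i" for i by (simp add: M_def column_def vec_eq_iff)
  show 1: "transpose M ** M = mat 1"
    by (simp add: matrix_mult_transpose_dot_column col assms(1) mat_def vec_eq_iff)
  then show 2: "M ** transpose M = mat 1" using matrix_left_right_inverse by blast
  show "invertible M" unfolding invertible_def using 1 2 by blast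
qed

lemma orthonormal_expansion:
  fixes u :: "'d \<Rightarrow> real ^ 'd"
  assumes u: "\<And>i j. u i \<bullet> u j = (if i = j then 1 else 0)"
  shows "(\<Sum>j\<in>UNIV. (u j \<bullet> \<xi>) *\<^sub>R u j) = \<xi>"
proof -
  define M where "M = (\<chi> r c. u c $ r)"
  note M = orthonormal_matrix[OF u, folded M_def]
  have "\<xi> = M *v (transpose M *v \<xi>)"
    by (metis M(3) matrix_vector_mul_assoc matrix_vector_mul_lid)
  also have "\<dots> = (\<Sum>j\<in>UNIV. (transpose M *v \<xi>) $ j *\<^sub>R u j)"
    by (simp only: matrix_mult_sum[of M] M(1) scalar_mult_eq_scaleR)
  moreover have "(transpose M *v \<xi>) $ j = u j \<bullet> \<xi>" for j
    by (simp add: matrix_vector_mult_def transpose_def M_def inner_vec_def del: transpose_matrix_vector)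
  ultimately show ?thesis by simp
qed

lemma inner_orthonormal_expansion:
  fixes u :: "'d \<Rightarrow> real ^ 'd"
  assumes u: "\<And>i j. u i \<bullet> u j = (if i = j then 1 else 0)"
  shows "y \<bullet> \<xi> = (\<Sum>j\<in>UNIV. (y \<bullet> u j) * (u j \<bullet> \<xi>))"
proof -
  have "y \<bullet> \<xi> = y \<bullet> (\<Sum>j\<in>UNIV. (u j \<bullet> \<xi>) *\<^sub>R u j)" by (simp add: orthonormal_expansion[OF u])
  then show ?thesis by (simp add: inner_sum_right mult.commute)
qed

text \<open>In an orthonormal eigenbasis the form is diagonal, so a quadratic phase splits into a sum of
one-dimensional phases.\<close>

lemma quadratic_form_eigenbasis:
  fixes u :: "'d \<Rightarrow> real ^ 'd"
  assumes u: "\<And>i j. u i \<bullet> u j = (if i = j then 1 else 0)" and l: "\<And>i. A *v u i = l i *\<^sub>R u i"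
    and sym: "transpose A = A"
  shows "\<xi> \<bullet> (A *v \<xi>) = (\<Sum>j\<in>UNIV. l j * (u j \<bullet> \<xi>)\<^sup>2)"
proof -
  have "\<xi> \<bullet> (A *v \<xi>) = (A *v \<xi>) \<bullet> \<xi>" by (simp add: inner_commute)
  also have "\<dots> = (\<Sum>j\<in>UNIV. ((A *v \<xi>) \<bullet> u j) * (u j \<bullet> \<xi>))"
    by (rule inner_orthonormal_expansion[OF u])
  also have "\<dots> = (\<Sum>j\<in>UNIV. l j * (u j \<bullet> \<xi>)\<^sup>2)"
  proof (intro sum.cong refl)
    fix j
    have "(A *v \<xi>) \<bullet> u j = l j * (u j \<bullet> \<xi>)"
      using symmetric_matrix_inner[OF sym, of \<xi> "u j"] by (simp add: l inner_commute)
    then show "((A *v \<xi>) \<bullet> u j) * (u j \<bullet> \<xi>) = l j * (u j \<bullet> \<xi>)\<^sup>2"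
      by (simp add: power2_eq_square)
  qed
  finally show ?thesis .
qed

text \<open>The matrix of the scalar form \<open>Q \<bullet> N\<close>, when \<open>A j\<close> is the matrix of the \<open>j\<close>-th component of \<open>Q\<close>.\<close>

definition pencil :: "('n \<Rightarrow> real ^ 'd ^ 'd) \<Rightarrow> real ^ 'n \<Rightarrow> real ^ 'd ^ 'd" where
  "pencil A N = (\<Sum>j\<in>UNIV. N $ j *\<^sub>R A j)"

lemma pencil_mult_vector: "pencil A N *v \<xi> = (\<Sum>j\<in>UNIV. N $ j *\<^sub>R (A j *v \<xi>))"
proof -
  have "(\<Sum>j\<in>F. N $ j *\<^sub>R A j) *v \<xi> = (\<Sum>j\<in>F. N $ j *\<^sub>R (A j *v \<xi>))" if "finite F" for F
    using that by (induction F rule: finite_induct)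
      (simp_all add: matrix_vector_mult_add_rdistrib scaleR_matrix_vector_assoc)
  then show ?thesis by (simp add: pencil_def)
qed

lemma transpose_pencil:
  assumes "\<And>j. transpose (A j) = A j"
  shows "transpose (pencil A N) = pencil A N"
proof -
  have "A j $ a $ b = A j $ b $ a" for j a b
  proof -
    have "A j $ a $ b = transpose (A j) $ b $ a" by (simp add: transpose_def)
    then show ?thesis unfolding assms .
  qed
  then show ?thesis by (simp add: pencil_def transpose_def vec_eq_iff)
qed

text \<open>Replacing a matrix by its symmetric part does not change its quadratic form.\<close>

lemma quadratic_forms_symmetric_matrices:
  fixes Q :: "real ^ 'd \<Rightarrow> real ^ 'n"
  assumes "\<And>j. quadratic_form (\<lambda>\<xi>. Q \<xi> $ j)"
  obtains A :: "'n \<Rightarrow> real ^ 'd ^ 'd" where "\<And>j. transpose (A j) = A j"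
    "\<And>\<xi> N. Q \<xi> \<bullet> N = \<xi> \<bullet> (pencil A N *v \<xi>)"
proof -
  have "\<forall>j. \<exists>B :: real ^ 'd ^ 'd. \<forall>\<xi>. Q \<xi> $ j = \<xi> \<bullet> (B *v \<xi>)"
    using assms by (simp add: quadratic_form_def)
  then obtain B where B: "\<And>j \<xi>. Q \<xi> $ j = \<xi> \<bullet> (B j *v \<xi>)" by metis
  define A where "A j = (1/2) *\<^sub>R (B j + transpose (B j))" for j
  have tr: "transpose (A j) = A j" for j
    by (simp add: A_def transpose_def vec_eq_iff add.commute)
  have "\<xi> \<bullet> (transpose (B j) *v \<xi>) = \<xi> \<bullet> (B j *v \<xi>)" for \<xi> j
    by (metis dot_lmul_matrix inner_commute transpose_matrix_vector)
  then have "Q \<xi> $ j = \<xi> \<bullet> (A j *v \<xi>)" for \<xi> j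
    by (simp add: B A_def scaleR_matrix_vector_assoc[symmetric] matrix_vector_mult_add_rdistrib inner_add_right)
  then have "Q \<xi> \<bullet> N = \<xi> \<bullet> (pencil A N *v \<xi>)" for \<xi> N
    by (simp add: pencil_mult_vector inner_sum_right inner_vec_def[of "Q \<xi>"] mult.commute)
  with tr show thesis using that by blast
qed

text \<open>The \<open>i\<close>-th partial derivative is the linear form \<open>\<xi> \<mapsto> 2 (A m) \<bullet> (M \<xi>)\<close> where \<open>m\<close> is the \<open>i\<close>-th column of \<open>M\<close>,
and this vanishes identically exactly when \<open>A m = 0\<close>.\<close>

lemma NV_quadratic:
  fixes A M :: "real ^ 'd ^ 'd"
  assumes sym: "transpose A = A" and inv: "invertible M"
  shows "NV (\<lambda>\<xi>. (M *v \<xi>) \<bullet> (A *v (M *v \<xi>))) = card {i. A *v column i M \<noteq> 0}"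
proof -
  have pd: "partial_deriv i (\<lambda>\<xi>. (M *v \<xi>) \<bullet> (A *v (M *v \<xi>))) \<xi> = 2 * ((A *v column i M) \<bullet> (M *v \<xi>))" for i \<xi>
  proof -
    have d: "((\<lambda>\<xi>. B *v \<xi>) has_derivative (\<lambda>h. B *v h)) (at \<xi>)" for B :: "real ^ 'd ^ 'd" and \<xi>
      by (rule bounded_linear_imp_has_derivative) simp
    have "((\<lambda>\<xi>. (M *v \<xi>) \<bullet> (A *v (M *v \<xi>))) has_derivative
        (\<lambda>h. (M *v \<xi>) \<bullet> (A *v (M *v h)) + (M *v h) \<bullet> (A *v (M *v \<xi>)))) (at \<xi>)"
      by (intro has_derivative_inner d has_derivative_compose[OF d d, simplified])
    from partial_deriv_has_derivative[OF this, of i]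
    have "partial_deriv i (\<lambda>\<xi>. (M *v \<xi>) \<bullet> (A *v (M *v \<xi>))) \<xi>
        = (M *v \<xi>) \<bullet> (A *v column i M) + column i M \<bullet> (A *v (M *v \<xi>))"
      by (simp only: matrix_vector_mult_basis)
    also have "column i M \<bullet> (A *v (M *v \<xi>)) = (A *v column i M) \<bullet> (M *v \<xi>)"
      by (rule symmetric_matrix_inner[OF sym])
    also have "(M *v \<xi>) \<bullet> (A *v column i M) = (A *v column i M) \<bullet> (M *v \<xi>)"
      by (rule inner_commute)
    finally show ?thesis by simp
  qed
  have "(\<exists>\<xi>. 2 * ((A *v column i M) \<bullet> (M *v \<xi>)) \<noteq> 0) \<longleftrightarrow> A *v column i M \<noteq> 0" for i
  proof
    assume "A *v column i M \<noteq> 0"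
    moreover obtain M' where "M ** M' = mat 1" using inv unfolding invertible_def by blast
    then have "M *v (M' *v w) = w" for w
      by (simp add: matrix_vector_mul_assoc)
    ultimately show "\<exists>\<xi>. 2 * ((A *v column i M) \<bullet> (M *v \<xi>)) \<noteq> 0"
      by (intro exI[of _ "M' *v (A *v column i M)"]) simp
  qed auto
  then show ?thesis by (simp add: NV_def pd)
qed

context
  fixes Q :: "real ^ 'd \<Rightarrow> real ^ 'n" and A :: "'n \<Rightarrow> real ^ 'd ^ 'd"
  assumes sym: "\<And>j. transpose (A j) = A j" and Q: "\<And>\<xi> N. Q \<xi> \<bullet> N = \<xi> \<bullet> (pencil A N *v \<xi>)"
begin

lemma d_frak1_pencil:
  "d_frak1 Q = (INF M \<in> {M :: real ^ 'd ^ 'd. invertible M}. INF N \<in> {N. N \<noteq> 0}. card {i. pencil A N *v column i M \<noteq> 0})"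
  unfolding d_frak1_def
  by (intro arg_cong[where f = Inf] image_cong refl) (simp add: Q NV_quadratic transpose_pencil sym)

lemma d_frak1_le:
  fixes M :: "real ^ 'd ^ 'd"
  assumes "N \<noteq> 0" "invertible M"
  shows "d_frak1 Q \<le> card {i. pencil A N *v column i M \<noteq> 0}"
proof -
  have "d_frak1 Q \<le> (INF N \<in> {N. N \<noteq> 0}. card {i. pencil A N *v column i M \<noteq> 0})"
    unfolding d_frak1_pencil
    by (rule cINF_lower[where f = "\<lambda>M :: real ^ 'd ^ 'd. INF N \<in> {N. N \<noteq> 0}. card {i. pencil A N *v column i M \<noteq> 0}"])
       (use assms(2) in auto)
  also have "\<dots> \<le> card {i. pencil A N *v column i M \<noteq> 0}"
    by (rule cINF_lower[where f = "\<lambda>N. card {i. pencil A N *v column i M \<noteq> 0}"])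
       (use assms(1) in auto)
  finally show ?thesis .
qed

lemma d_frak1_le_orthonormal:
  fixes u :: "'d \<Rightarrow> real ^ 'd"
  assumes "N \<noteq> 0" "\<And>i j. u i \<bullet> u j = (if i = j then 1 else 0)"
  shows "d_frak1 Q \<le> card {i. pencil A N *v u i \<noteq> 0}"
  using d_frak1_le[OF assms(1) orthonormal_matrix(4)[OF assms(2)]] orthonormal_matrix(1)[OF assms(2)] by simp

lemma d_frak1_attained:
  obtains M :: "real ^ 'd ^ 'd" and N where "invertible M" "N \<noteq> 0" "d_frak1 Q = card {i. pencil A N *v column i M \<noteq> 0}"
proof -
  have "invertible (mat 1 :: real ^ 'd ^ 'd)"
    unfolding invertible_def by (intro exI[of _ "mat 1"]) simp
  then have ne: "{M :: real ^ 'd ^ 'd. invertible M} \<noteq> {}" by blast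
  have "axis undefined 1 \<noteq> (0 :: real ^ 'n)" by simp
  then have ne2: "{N :: real ^ 'n. N \<noteq> 0} \<noteq> {}" by blast
  have "d_frak1 Q \<in> (\<lambda>M :: real ^ 'd ^ 'd. INF N \<in> {N. N \<noteq> 0}. card {i. pencil A N *v column i M \<noteq> 0}) ` {M. invertible M}"
    unfolding d_frak1_pencil by (rule Inf_nat_def1) (use ne in auto)
  then obtain M :: "real ^ 'd ^ 'd" where M: "d_frak1 Q = (INF N \<in> {N. N \<noteq> 0}. card {i. pencil A N *v column i M \<noteq> 0})"
    "M \<in> {M. invertible M}"
    by (rule imageE)
  moreover have "(INF N \<in> {N. N \<noteq> 0}. card {i. pencil A N *v column i M \<noteq> 0}) \<in> (\<lambda>N. card {i. pencil A N *v column i M \<noteq> 0}) ` {N. N \<noteq> 0}"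
    by (rule Inf_nat_def1) (use ne2 in auto)
  ultimately show thesis using that by auto
qed

text \<open>The minimum over \<open>M\<close> and \<open>N\<close> is at least the smallest rank in the pencil: the range of the matrix
is spanned by the images of the columns of \<open>M\<close>, and it contains the eigenvectors with nonzero eigenvalue,
which are independent.\<close>

lemma d_frak1_eigenvalues:
  obtains N and u :: "'d \<Rightarrow> real ^ 'd" and l where "N \<noteq> 0" "\<And>i j. u i \<bullet> u j = (if i = j then 1 else (0::real))"
    "\<And>i. pencil A N *v u i = l i *\<^sub>R u i" "card {i. l i \<noteq> 0} \<le> d_frak1 Q"
proof -
  obtain M :: "real ^ 'd ^ 'd" and N where M: "invertible M" and N: "N \<noteq> 0" and eq: "d_frak1 Q = card {i. pencil A N *v column i M \<noteq> 0}"
    by (rule d_frak1_attained)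
  define B where "B = pencil A N"
  obtain u :: "'d \<Rightarrow> real ^ 'd" and l where u: "\<And>i j. u i \<bullet> u j = (if i = j then 1 else 0)"
    and l: "\<And>i. B *v u i = l i *\<^sub>R u i"
  proof (rule symmetric_orthonormal_eigenbasis)
    show "transpose B = B" unfolding B_def by (rule transpose_pencil[OF sym])
  qed (rule that)
  have inj: "inj_on u S" for S
  proof (rule inj_onI)
    fix i j assume "u i = u j"
    then have "u i \<bullet> u j = 1" using u[of i i] by simp
    then show "i = j" using u[of i j] by (simp split: if_splits)
  qed
  have u0: "u i \<noteq> 0" for i using u[of i i] by auto
  let ?T = "(\<lambda>i. B *v column i M) ` {i. B *v column i M \<noteq> 0}"
  have range: "B *v x \<in> span ?T" for x
  proof -
    obtain M' where "M ** M' = mat 1" using M unfolding invertible_def by blast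
    then have "M *v (M' *v x) = x" by (simp add: matrix_vector_mul_assoc)
    then have "B *v x = B *v (M *v (M' *v x))" by simp
    also have "\<dots> = (\<Sum>i\<in>UNIV. (M' *v x) $ i *\<^sub>R (B *v column i M))"
      unfolding matrix_mult_sum[of M] scalar_mult_eq_scaleR
      by (simp only: linear_sum[OF matrix_vector_mul_linear] linear_scale[OF matrix_vector_mul_linear])
    also have "\<dots> \<in> span ?T"
    proof (intro span_sum span_scale)
      fix i show "B *v column i M \<in> span ?T"
        by (cases "B *v column i M = 0") (auto intro: span_zero span_base)
    qed
    finally show ?thesis .
  qed
  have ind: "independent (u ` {i. l i \<noteq> 0})"
    by (rule pairwise_orthogonal_independent) (auto simp: pairwise_def orthogonal_def u u0)
  have "u ` {i. l i \<noteq> 0} \<subseteq> span ?T"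
  proof
    fix v assume "v \<in> u ` {i. l i \<noteq> 0}"
    then obtain i where i: "v = u i" "l i \<noteq> 0" by blast
    then have "v = (1 / l i) *\<^sub>R (B *v u i)" by (simp add: l)
    then show "v \<in> span ?T" using range span_scale by metis
  qed
  then have "card (u ` {i. l i \<noteq> 0}) \<le> card ?T"
    using independent_span_bound[OF _ ind, of ?T] by simp
  also have "card ?T \<le> d_frak1 Q" unfolding eq B_def by (rule card_image_le) simp
  finally have "card {i. l i \<noteq> 0} \<le> d_frak1 Q" by (simp add: card_image inj)
  then show thesis using that[OF N u l[unfolded B_def]] by blast
qed

text \<open>A nonzero member of the pencil has a nonzero value at no fewer than \<open>d_frak1 Q\<close> vectors of any orthonormal
basis. The sum over all index sets \<open>J\<close> of that size of the products below is therefore a positive continuous function on the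
compact set of unit vectors \<open>N\<close> and orthonormal bases, which gives a positive lower bound uniform in \<open>N\<close>.\<close>

lemma d_frak1_uniform_minor:
  obtains c where "c > 0"
    "\<And>N (u :: 'd \<Rightarrow> real ^ 'd). norm N = 1 \<Longrightarrow> (\<And>i j. u i \<bullet> u j = (if i = j then 1 else 0)) \<Longrightarrow>
      \<exists>J. card J = d_frak1 Q \<and> c \<le> (\<Prod>j\<in>J. norm (pencil A N *v u j))"
proof -
  define K where "K = {J :: 'd set. card J = d_frak1 Q}"
  define F where "F = (\<lambda>(N, U :: real ^ 'd ^ 'd). \<Sum>J\<in>K. \<Prod>j\<in>J. norm (pencil A N *v (U $ j)))"
  define X where "X = {(N :: real ^ 'n, U :: real ^ 'd ^ 'd). norm N = 1 \<and> (\<forall>i j. U $ i \<bullet> U $ j = (if i = j then 1 else 0))}"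
  have cF: "continuous_on X F"
    unfolding F_def pencil_mult_vector case_prod_beta
    by (intro continuous_intros linear_continuous_on[OF matrix_vector_mul_bounded_linear, THEN continuous_on_compose2]) auto
  have "closed X"
  proof -
    have "X = (\<Inter>i. \<Inter>j. {x. norm (fst x) = 1} \<inter> {x. snd x $ i \<bullet> snd x $ j = (if i = j then 1 else 0)})"
      by (auto simp: X_def)
    also have "closed \<dots>" by (intro closed_INT closed_Int closed_Collect_eq continuous_intros ballI)
    finally show ?thesis .
  qed
  moreover have "bounded X"
  proof -
    have "norm x \<le> 1 + real CARD('d)" if "x \<in> X" for x
    proof -
      have 1: "norm (fst x) = 1" "\<And>i. norm (snd x $ i) = 1"
        using that by (auto simp: X_def norm_eq_1)
      have "norm (snd x) \<le> (\<Sum>i\<in>UNIV. norm (snd x $ i))"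
        unfolding norm_vec_def by (rule L2_set_le_sum) simp
      then have "norm (snd x) \<le> real CARD('d)" by (simp add: 1)
      then show ?thesis using norm_Pair_le[of "fst x" "snd x"] 1 by simp
    qed
    then show ?thesis by (rule boundedI)
  qed
  ultimately have "compact X" by (simp add: compact_eq_bounded_closed)
  have "(axis undefined 1, mat 1) \<in> X"
    by (auto simp: X_def mat_def inner_vec_def if_distrib[of "\<lambda>x. x * _"] cong: if_cong)
  then have "X \<noteq> {}" by blast
  obtain x0 where x0: "x0 \<in> X" "\<And>x. x \<in> X \<Longrightarrow> F x0 \<le> F x"
    using continuous_attains_inf[OF \<open>compact X\<close> \<open>X \<noteq> {}\<close> cF] by blast
  have pos: "F x > 0" if "x \<in> X" for x
  proof -
    obtain N U where x: "x = (N, U)" by (cases x)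
    have NU: "norm N = 1" "\<And>i j. U $ i \<bullet> U $ j = (if i = j then 1 else 0)" using that by (auto simp: X_def x)
    have "d_frak1 Q \<le> card {i. pencil A N *v (U $ i) \<noteq> 0}"
      by (rule d_frak1_le_orthonormal) (use NU in auto)
    then obtain J where J: "J \<subseteq> {i. pencil A N *v (U $ i) \<noteq> 0}" "card J = d_frak1 Q"
      by (meson obtain_subset_with_card_n)
    show ?thesis unfolding F_def x prod.case
    proof (rule sum_pos2[where i = J])
      show "(\<Prod>j\<in>J. norm (pencil A N *v (U $ j))) > 0" using J by (intro prod_pos) auto
    qed (use J in \<open>auto simp: K_def intro!: prod_nonneg\<close>)
  qed
  have cK: "card K > 0"
  proof (rule ccontr)
    assume "\<not> card K > 0"
    then have "K = {}" by simp
    then have "F x0 = 0" by (simp add: F_def case_prod_beta)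
    with pos[OF x0(1)] show False by simp
  qed
  show thesis
  proof (rule that[of "F x0 / card K"])
    show "F x0 / card K > 0" using pos[OF x0(1)] cK by simp
    fix N :: "real ^ 'n" and u :: "'d \<Rightarrow> real ^ 'd"
    assume "norm N = 1" "\<And>i j. u i \<bullet> u j = (if i = j then 1 else 0)"
    then have "(N, \<chi> i. u i) \<in> X" by (simp add: X_def)
    from x0(2)[OF this] have le: "F x0 \<le> (\<Sum>J\<in>K. \<Prod>j\<in>J. norm (pencil A N *v u j))"
      by (simp add: F_def)
    show "\<exists>J. card J = d_frak1 Q \<and> F x0 / card K \<le> (\<Prod>j\<in>J. norm (pencil A N *v u j))"
    proof (rule ccontr)
      assume "\<not> ?thesis"
      then have "(\<Prod>j\<in>J. norm (pencil A N *v u j)) < F x0 / card K" if "J \<in> K" for J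
        using that by (force simp: K_def)
      then have "(\<Sum>J\<in>K. \<Prod>j\<in>J. norm (pencil A N *v u j)) < of_nat (card K) * (F x0 / card K)"
        by (rule sum_bounded_above_strict) (use cK in auto)
      moreover have "of_nat (card K) * (F x0 / card K) = F x0" using cK by (cases "K = {}") auto
      ultimately show False using le by linarith
    qed
  qed
qed

end

section \<open>Decay of the oscillatory integral\<close>

lemma powr_minus_halved:
  fixes x r :: real
  assumes "x \<ge> 0"
  shows "(x / 2) powr (- r) = 2 powr r * x powr (- r)"
proof -
  have "(x / 2) powr (- r) = x powr (- r) / 2 powr (- r)" using assms by (simp only: powr_divide)
  also have "(2::real) powr (- r) = inverse (2 powr r)" by (rule powr_minus)
  finally show ?thesis by (simp only: divide_inverse inverse_inverse_eq mult.commute)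
qed

text \<open>The operator under study applied to the constant function 1, with the frequency split into its
tangential part \<open>y\<close> and its normal part \<open>z\<close> and with a general amplitude \<open>g\<close>.\<close>

definition osc :: "(real ^ 'd \<Rightarrow> real ^ 'n) \<Rightarrow> (real ^ 'd \<Rightarrow> complex) \<Rightarrow> real ^ 'd \<Rightarrow> real ^ 'n \<Rightarrow> complex" where
  "osc Q g y z = (LINT \<xi>|lborel. exp (\<i> * of_real (y \<bullet> \<xi> + Q \<xi> \<bullet> z)) * g \<xi>)"

lemma integrable_test_function: "test_function (g :: real ^ 'd \<Rightarrow> complex) \<Longrightarrow> integrable lborel g"
  by (rule test_function_bounded_support)
     (auto intro: integrable_continuous_bounded_support dest: test_function_continuous)

lemma norm_osc_le: 
  assumes "integrable lborel g"
  shows "norm (osc Q g y z) \<le> (LINT \<xi>|lborel. norm (g \<xi>))"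
proof -
  have "norm (osc Q g y z) \<le> (LINT \<xi>|lborel. norm (exp (\<i> * of_real (y \<bullet> \<xi> + Q \<xi> \<bullet> z)) * g \<xi>))"
    unfolding osc_def by (rule integral_norm_bound)
  also have "\<dots> = (LINT \<xi>|lborel. norm (g \<xi>))" by (simp only: norm_mult norm_exp_i_times mult_1)
  finally show ?thesis .
qed

context
  fixes Q :: "real ^ 'd \<Rightarrow> real ^ 'n" and A :: "'n \<Rightarrow> real ^ 'd ^ 'd"
  assumes sym: "\<And>j. transpose (A j) = A j" and Q: "\<And>\<xi> N. Q \<xi> \<bullet> N = \<xi> \<bullet> (pencil A N *v \<xi>)"
begin

text \<open>In an orthonormal eigenbasis of the matrix of \<open>Q \<bullet> (z / \<bar>z\<bar>)\<close> the phase separates. Integrating by parts in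
\<open>d_frak1 Q\<close> of the eigendirections gains \<open>C / sqrt (\<bar>z\<bar> \<bar>l j\<bar>)\<close> in each, and the product of the eigenvalues
involved is bounded below uniformly in the direction of \<open>z\<close>.\<close>

lemma osc_decay_in_normal_direction:
  assumes g: "test_function g"
  shows "\<exists>C\<ge>0. \<forall>y z. norm (osc Q g y z) \<le> C * (1 + norm z) powr (- (real (d_frak1 Q) / 2))"
proof -
  define m where "m = d_frak1 Q"
  obtain C0 :: real where C0: "C0 > 0" and prim:
    "\<And>y \<mu>. \<mu> \<noteq> 0 \<Longrightarrow> \<exists>K. (\<forall>s. (K has_vector_derivative exp (\<i> * of_real (y * s + \<mu> * s\<^sup>2))) (at s))
        \<and> (\<forall>s. norm (K s) \<le> C0 / sqrt \<bar>\<mu>\<bar>)"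
    by (rule quadratic_phase_primitive) blast
  obtain c where c: "c > 0" and minor: "\<And>N (u :: 'd \<Rightarrow> real ^ 'd). norm N = 1 \<Longrightarrow> (\<And>i j. u i \<bullet> u j = (if i = j then 1 else 0)) \<Longrightarrow>
      \<exists>J. card J = m \<and> c \<le> (\<Prod>j\<in>J. norm (pencil A N *v u j))"
    unfolding m_def by (rule d_frak1_uniform_minor[OF sym Q]) blast
  have "\<forall>S :: 'd set. \<exists>C\<ge>0. \<forall>u K E B W. oscillatory_factors S u K E B W \<longrightarrow>
      norm (LINT x|lborel. W x * (\<Prod>j\<in>S. E j (u j \<bullet> x)) * g x) \<le> C * (\<Prod>j\<in>S. B j)"
    by (intro allI oscillatory_integral_multi_parts[OF _ g]) simp
  then obtain CS where CS0: "\<And>S :: 'd set. CS S \<ge> 0" and CS: "\<And>(S :: 'd set) u K E B W. oscillatory_factors S u K E B W \<Longrightarrow>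
      norm (LINT x|lborel. W x * (\<Prod>j\<in>S. E j (u j \<bullet> x)) * g x) \<le> CS S * (\<Prod>j\<in>S. B j)"
    unfolding choice_iff by (elim exE) blast
  \<comment> \<open>The constants for all subsets are added up since the set \<open>J\<close> varies with \<open>z\<close>.\<close>
  define C1 where "C1 = (\<Sum>S\<in>UNIV. CS S) * (C0 ^ m / sqrt c)"
  have C1: "C1 \<ge> 0" using CS0 C0 c by (simp add: C1_def sum_nonneg)
  have large: "norm (osc Q g y z) \<le> C1 * norm z powr (- (real m / 2))" if z: "z \<noteq> 0" for y z
  proof -
    define t where "t = norm z"
    define N where "N = z /\<^sub>R t"
    have t: "t > 0" "norm N = 1" "z = t *\<^sub>R N" using z by (auto simp: t_def N_def)
    obtain u :: "'d \<Rightarrow> real ^ 'd" and l where u: "\<And>i j. u i \<bullet> u j = (if i = j then 1 else 0)"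
      and l: "\<And>i. pencil A N *v u i = l i *\<^sub>R u i"
    proof (rule symmetric_orthonormal_eigenbasis)
      show "transpose (pencil A N) = pencil A N" by (rule transpose_pencil[OF sym])
    qed (rule that)
    have nu: "norm (u j) = 1" for j using u[of j j] by (simp add: norm_eq_1)
    obtain J where J: "card J = m" "c \<le> (\<Prod>j\<in>J. norm (pencil A N *v u j))"
      using minor[OF t(2) u] by blast
    then have cl: "c \<le> (\<Prod>j\<in>J. \<bar>l j\<bar>)" by (simp add: l nu)
    have l0: "l j \<noteq> 0" if "j \<in> J" for j
    proof
      assume "l j = 0"
      then have "(\<Prod>j\<in>J. \<bar>l j\<bar>) = 0" using that by (intro prod_zero) auto
      with cl c show False by linarith
    qed
    define E where "E j s = exp (\<i> * of_real ((y \<bullet> u j) * s + (t * l j) * s\<^sup>2))" for j s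
    have "\<forall>j. \<exists>K. j \<in> J \<longrightarrow> (\<forall>s. (K has_vector_derivative E j s) (at s)) \<and> (\<forall>s. norm (K s) \<le> C0 / sqrt \<bar>t * l j\<bar>)"
    proof
      fix j
      show "\<exists>K. j \<in> J \<longrightarrow> (\<forall>s. (K has_vector_derivative E j s) (at s)) \<and> (\<forall>s. norm (K s) \<le> C0 / sqrt \<bar>t * l j\<bar>)"
      proof (cases "j \<in> J")
        case True
        then have "t * l j \<noteq> 0" using l0 t by simp
        from prim[OF this, of "y \<bullet> u j"] show ?thesis unfolding E_def by blast
      qed simp
    qed
    then obtain K where K: "\<And>j s. j \<in> J \<Longrightarrow> (K j has_vector_derivative E j s) (at s)"
      "\<And>j s. j \<in> J \<Longrightarrow> norm (K j s) \<le> C0 / sqrt \<bar>t * l j\<bar>"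
      unfolding choice_iff by (elim exE) blast
    define W where "W \<xi> = (\<Prod>j\<in>-J. E j (u j \<bullet> \<xi>))" for \<xi>
    have cE: "continuous_on UNIV (E j)" for j unfolding E_def by (intro continuous_intros)
    have nE: "norm (E j s) = 1" for j s unfolding E_def by (simp only: norm_exp_i_times)
    have "oscillatory_factors J u K E (\<lambda>j. C0 / sqrt \<bar>t * l j\<bar>) W"
      unfolding oscillatory_factors_def
    proof (intro conjI ballI allI impI)
      show "continuous_on UNIV W" unfolding W_def
        by (intro continuous_intros continuous_on_compose2[OF cE]) auto
      show "norm (W x) \<le> 1" for x unfolding W_def by (simp add: prod_norm[symmetric] nE)
      show "W (x + s *\<^sub>R u j) = W x" if "j \<in> J" for j x s
      proof -
        have "u i \<bullet> u j = 0" if "i \<in> - J" for i using that \<open>j \<in> J\<close> u[of i j] by auto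
        then show ?thesis unfolding W_def by (intro prod.cong refl) (simp add: inner_add_right)
      qed
      show "0 < C0 / sqrt \<bar>t * l j\<bar>" if "j \<in> J" for j using C0 t l0[OF that] by simp
    qed (use K nE cE nu u in auto)
    from CS[OF this] have bd: "norm (LINT x|lborel. W x * (\<Prod>j\<in>J. E j (u j \<bullet> x)) * g x) \<le> CS J * (\<Prod>j\<in>J. C0 / sqrt \<bar>t * l j\<bar>)" .
    have "W \<xi> * (\<Prod>j\<in>J. E j (u j \<bullet> \<xi>)) = exp (\<i> * of_real (y \<bullet> \<xi> + Q \<xi> \<bullet> z))" for \<xi>
    proof -
      have "W \<xi> * (\<Prod>j\<in>J. E j (u j \<bullet> \<xi>)) = (\<Prod>j\<in>UNIV. E j (u j \<bullet> \<xi>))"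
        unfolding W_def by (subst prod.union_disjoint[symmetric]) (auto simp: Un_commute)
      also have "\<dots> = exp (\<i> * of_real (\<Sum>j\<in>UNIV. (y \<bullet> u j) * (u j \<bullet> \<xi>) + t * (l j * (u j \<bullet> \<xi>)\<^sup>2)))"
        unfolding E_def by (simp add: exp_sum[symmetric] sum_distrib_left mult.assoc)
      also have "(\<Sum>j\<in>UNIV. (y \<bullet> u j) * (u j \<bullet> \<xi>) + t * (l j * (u j \<bullet> \<xi>)\<^sup>2)) = y \<bullet> \<xi> + t * (Q \<xi> \<bullet> N)"
        unfolding Q quadratic_form_eigenbasis[OF u l transpose_pencil[of A N, OF sym]]
        by (simp add: inner_orthonormal_expansion[OF u, of y \<xi>] sum.distrib sum_distrib_left)
      finally show ?thesis by (simp add: t(3))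
    qed
    then have "norm (osc Q g y z) \<le> CS J * (\<Prod>j\<in>J. C0 / sqrt \<bar>t * l j\<bar>)"
      using bd by (simp add: osc_def)
    also have "(\<Prod>j\<in>J. C0 / sqrt \<bar>t * l j\<bar>) = C0 ^ m / (sqrt t ^ m * sqrt (\<Prod>j\<in>J. \<bar>l j\<bar>))"
    proof -
      have "sqrt (\<Prod>j\<in>J. \<bar>l j\<bar>) = (\<Prod>j\<in>J. sqrt \<bar>l j\<bar>)"
        by (induction J rule: infinite_finite_induct) (auto simp: real_sqrt_mult)
      then show ?thesis
        using t J(1) by (simp add: abs_mult real_sqrt_mult prod_dividef prod.distrib)
    qed
    also have "\<dots> \<le> C0 ^ m / (sqrt t ^ m * sqrt c)"
      using C0 c cl t by (intro divide_left_mono mult_left_mono mult_pos_pos) auto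
    also have "\<dots> = C0 ^ m / sqrt c * norm z powr (- (real m / 2))"
    proof -
      have "sqrt t ^ m = t powr (real m / 2)"
        using t by (simp add: powr_half_sqrt[symmetric] powr_realpow[symmetric] powr_powr)
      then show ?thesis
        by (simp only: t_def[symmetric] powr_minus divide_inverse inverse_mult_distrib mult_ac)
    qed
    finally have "norm (osc Q g y z) \<le> CS J * (C0 ^ m / sqrt c * norm z powr (- (real m / 2)))"
      using CS0 by (simp add: mult_left_mono)
    also have "\<dots> \<le> (\<Sum>S\<in>UNIV. CS S) * (C0 ^ m / sqrt c * norm z powr (- (real m / 2)))"
      using CS0 C0 c by (intro mult_right_mono member_le_sum) auto
    finally show ?thesis by (simp add: C1_def mult.assoc)
  qed
  define C2 where "C2 = (LINT \<xi>|lborel. norm (g \<xi>))"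
  have C2: "C2 \<ge> 0" by (simp add: C2_def)
  show ?thesis
  proof (intro exI[of _ "(C1 + C2) * 2 powr (real m / 2)"] conjI allI)
    show "0 \<le> (C1 + C2) * 2 powr (real m / 2)" using C1 C2 by simp
    fix y :: "real ^ 'd" and z :: "real ^ 'n"
    have scale: "2 powr (real m / 2) * (1 + norm z) powr (- (real m / 2)) = ((1 + norm z) / 2) powr (- (real m / 2))"
      by (rule powr_minus_halved[symmetric]) (simp add: add_nonneg_nonneg)
    have "norm (osc Q g y z) \<le> (C1 + C2) * ((1 + norm z) / 2) powr (- (real m / 2))"
    proof (cases "norm z \<ge> 1")
      case True
      then have "z \<noteq> 0" by auto
      have "norm (osc Q g y z) \<le> C1 * norm z powr (- (real m / 2))" using large[OF \<open>z \<noteq> 0\<close>] .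
      also have "\<dots> \<le> (C1 + C2) * ((1 + norm z) / 2) powr (- (real m / 2))"
        using True C1 C2 by (intro mult_mono powr_mono2') auto
      finally show ?thesis .
    next
      case False
      have "norm (osc Q g y z) \<le> C2 * 1"
        using norm_osc_le[OF integrable_test_function[OF g]] by (simp add: C2_def)
      also have "\<dots> \<le> (C1 + C2) * ((1 + norm z) / 2) powr (- (real m / 2))"
      proof (intro mult_mono)
        have "1 powr (- (real m / 2)) \<le> ((1 + norm z) / 2) powr (- (real m / 2))"
          using False by (intro powr_mono2') (auto intro: add_pos_nonneg)
        then show "1 \<le> ((1 + norm z) / 2) powr (- (real m / 2))" by simp
      qed (use C1 C2 in auto)
      finally show ?thesis .
    qed
    then show "norm (osc Q g y z) \<le> (C1 + C2) * 2 powr (real m / 2) * (1 + norm z) powr (- (real (d_frak1 Q) / 2))"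
      using scale by (simp add: m_def mult.assoc)
  qed
qed

text \<open>The integral of \<open>\<partial>\<^sub>i (exp (\<i> phase) g)\<close> vanishes. Since \<open>\<partial>\<^sub>i\<close> of the phase is \<open>y $ i\<close> plus a linear form in \<open>\<xi>\<close>
with coefficients linear in \<open>z\<close>, a factor \<open>y $ i\<close> can be traded for at most one factor \<open>z $ j\<close>, at the price of
replacing the amplitude by another test function.\<close>

lemma osc_integration_by_parts:
  assumes g: "test_function g"
  shows "of_real (y $ i) * osc Q g y z = \<i> * osc Q (partial_deriv i g) y z
    - (\<Sum>j\<in>UNIV. of_real (z $ j) * osc Q (\<lambda>\<xi>. of_real ((2 *\<^sub>R (A j *v axis i 1)) \<bullet> \<xi>) * g \<xi>) y z)"
proof -
  define e where "e = (axis i 1 :: real ^ 'd)"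
  define P where "P \<xi> = exp (\<i> * of_real (y \<bullet> \<xi> + Q \<xi> \<bullet> z))" for \<xi>
  define lin where "lin j \<xi> = of_real ((2 *\<^sub>R (A j *v e)) \<bullet> \<xi>) * g \<xi>" for j \<xi>
  obtain R where R: "\<And>x. norm x > R \<Longrightarrow> g x = 0" using test_function_bounded_support[OF g] by blast
  have cg: "continuous_on UNIV g" "continuous_on UNIV (partial_deriv i g)"
    using g by (auto intro: test_function_continuous test_function_partial_deriv)
  have test: "test_function (partial_deriv i g)" "test_function (lin j)" for j
    unfolding lin_def by (rule test_function_partial_deriv[OF g]) (rule test_function_linear_times[OF g])
  have cQ: "continuous_on UNIV (\<lambda>\<xi>. Q \<xi> \<bullet> z)"
    unfolding Q by (intro continuous_intros linear_continuous_on matrix_vector_mul_bounded_linear)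
  have cP: "continuous_on UNIV P"
    unfolding P_def by (intro continuous_intros cQ)
  have oscP: "osc Q f y z = (LINT \<xi>|lborel. P \<xi> * f \<xi>)" for f
    by (simp only: osc_def P_def)
  define h' where "h' \<xi> = P \<xi> * partial_deriv i g \<xi> + \<i> * of_real (y $ i + 2 * ((pencil A z *v e) \<bullet> \<xi>)) * P \<xi> * g \<xi>" for \<xi>
  have "(LINT \<xi>|lborel. 1 * h' \<xi>) = 0"
  proof (rule integral_directional_derivative_eq_0[where h = "\<lambda>\<xi>. P \<xi> * g \<xi>" and u = e and R = R])
    show "continuous_on UNIV h'" unfolding h'_def by (intro continuous_intros cP cg)
    show "((\<lambda>s. P (x + s *\<^sub>R e) * g (x + s *\<^sub>R e)) has_vector_derivative h' x) (at 0)" for x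
    proof -
      have g1: "((\<lambda>s. g (x + s *\<^sub>R e)) has_vector_derivative partial_deriv i g x) (at 0)"
      proof -
        obtain g' where g': "(g has_derivative g') (at x)"
          using test_function_differentiable[OF g] unfolding differentiable_def by blast
        from has_vector_derivative_line[OF this, of e] partial_deriv_has_derivative[OF this, of i]
        show ?thesis by (simp add: e_def)
      qed
      define a where "a = y \<bullet> x + Q x \<bullet> z"
      define b where "b = y $ i + 2 * ((pencil A z *v e) \<bullet> x)"
      define k where "k = e \<bullet> (pencil A z *v e)"
      have ph: "y \<bullet> (x + s *\<^sub>R e) + Q (x + s *\<^sub>R e) \<bullet> z = a + s * b + s\<^sup>2 * k" for s
      proof -
        have "x \<bullet> (pencil A z *v e) = e \<bullet> (pencil A z *v x)"
          using symmetric_matrix_inner[OF transpose_pencil[of A z, OF sym], of e x] by (simp add: inner_commute)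
        then show ?thesis
          by (simp add: a_def b_def k_def Q inner_add_left inner_add_right matrix_vector_right_distrib
              matrix_vector_mult_scaleR power2_eq_square algebra_simps inner_commute[of _ x] e_def inner_axis)
      qed
      have "((\<lambda>s. \<i> * (of_real a + s * of_real b + s\<^sup>2 * of_real k)) has_field_derivative \<i> * of_real b) (at (of_real 0))"
        by (auto intro!: derivative_eq_intros)
      from DERIV_fun_exp[OF this]
      have "((\<lambda>s. exp (\<i> * (of_real a + s * of_real b + s\<^sup>2 * of_real k))) has_field_derivative exp (\<i> * of_real a) * (\<i> * of_real b)) (at (of_real 0))"
        by simp
      from has_vector_derivative_real_field[OF this]
      have P1: "((\<lambda>s. P (x + s *\<^sub>R e)) has_vector_derivative P x * (\<i> * of_real b)) (at 0)"
        unfolding P_def ph by (simp add: a_def)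
      show ?thesis
        using has_vector_derivative_mult[OF P1 g1] by (simp add: h'_def b_def mult_ac)
    qed
    show "continuous_on UNIV (\<lambda>\<xi>. P \<xi> * g \<xi>)" by (intro continuous_intros cP cg)
  qed (use R in auto)
  moreover have "1 * h' \<xi> = P \<xi> * partial_deriv i g \<xi> + \<i> * (of_real (y $ i) * (P \<xi> * g \<xi>)
      + (\<Sum>j\<in>UNIV. of_real (z $ j) * (P \<xi> * lin j \<xi>)))" for \<xi>
  proof -
    have "of_real (2 * ((pencil A z *v e) \<bullet> \<xi>)) * (P \<xi> * g \<xi>) = (\<Sum>j\<in>UNIV. of_real (z $ j) * (P \<xi> * lin j \<xi>))"
      by (simp add: pencil_mult_vector inner_sum_left sum_distrib_left sum_distrib_right lin_def mult_ac)
    then show ?thesis by (simp add: h'_def algebra_simps)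
  qed
  moreover have int: "integrable lborel (\<lambda>\<xi>. P \<xi> * f \<xi>)" if f: "test_function f" for f
  proof -
    obtain R where "\<And>x. norm x > R \<Longrightarrow> f x = 0" using test_function_bounded_support[OF f] by blast
    then show ?thesis
      by (intro integrable_continuous_bounded_support[where R = R] continuous_intros cP test_function_continuous[OF f]) auto
  qed
  ultimately have "osc Q (partial_deriv i g) y z + \<i> * (of_real (y $ i) * osc Q g y z + (\<Sum>j\<in>UNIV. of_real (z $ j) * osc Q (lin j) y z)) = 0"
    using int[OF g] int[OF test(1)] int[OF test(2)]
    by (simp add: oscP Bochner_Integration.integral_add Bochner_Integration.integral_sum Bochner_Integration.integrable_sum)
  moreover have "b + s = \<i> * p" if "p + \<i> * (b + s) = 0" for b s p :: complex
  proof -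
    have "p = - (\<i> * (b + s))" using that by (simp only: eq_neg_iff_add_eq_0)
    then show ?thesis by simp
  qed
  ultimately have "of_real (y $ i) * osc Q g y z + (\<Sum>j\<in>UNIV. of_real (z $ j) * osc Q (lin j) y z)
      = \<i> * osc Q (partial_deriv i g) y z"
    by blast
  then show ?thesis
    unfolding lin_def e_def by (simp only: eq_diff_eq)
qed

text \<open>Trading \<open>k\<close> factors of \<open>\<bar>y\<bar>\<close> for factors of \<open>1 + \<bar>z\<bar>\<close> keeps the full gain from the normal direction, because the
integrals that appear are of the same kind with other amplitudes.\<close>

lemma osc_decay_in_tangential_direction:
  assumes "test_function g"
  shows "\<exists>C\<ge>0. \<forall>y z. norm y ^ k * norm (osc Q g y z) \<le> C * (1 + norm z) powr (real k - real (d_frak1 Q) / 2)"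
  using assms
proof (induction k arbitrary: g)
  case 0
  then show ?case using osc_decay_in_normal_direction by simp
next
  case (Suc k)
  define m where "m = real (d_frak1 Q)"
  let ?lin = "\<lambda>i j \<xi>. of_real ((2 *\<^sub>R (A j *v axis i 1)) \<bullet> \<xi>) * g \<xi>"
  have "\<forall>i. \<exists>C\<ge>0. \<forall>y z. norm y ^ k * norm (osc Q (partial_deriv i g) y z) \<le> C * (1 + norm z) powr (real k - m / 2)"
    unfolding m_def by (intro allI Suc.IH test_function_partial_deriv Suc.prems)
  note this[unfolded choice_iff]
  then obtain a where a: "\<And>i. a i \<ge> 0" "\<And>i y z. norm y ^ k * norm (osc Q (partial_deriv i g) y z) \<le> a i * (1 + norm z) powr (real k - m / 2)"
    by (elim exE) blast
  have "\<forall>i j. \<exists>C\<ge>0. \<forall>y z. norm y ^ k * norm (osc Q (?lin i j) y z) \<le> C * (1 + norm z) powr (real k - m / 2)"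
    unfolding m_def by (intro allI Suc.IH test_function_linear_times Suc.prems)
  note this[unfolded choice_iff]
  then obtain b where b: "\<And>i j. b i j \<ge> 0" "\<And>i j y z. norm y ^ k * norm (osc Q (?lin i j) y z) \<le> b i j * (1 + norm z) powr (real k - m / 2)"
    by (elim exE) blast
  define C where "C = (\<Sum>i\<in>UNIV. a i + (\<Sum>j\<in>UNIV. b i j))"
  show ?case
  proof (intro exI[of _ C] conjI allI)
    show "C \<ge> 0" unfolding C_def using a b by (intro sum_nonneg add_nonneg_nonneg) auto
    fix y :: "real ^ 'd" and z :: "real ^ 'n"
    let ?X = "(1 + norm z) powr (real k - m / 2)"
    have step: "norm y ^ k * norm (of_real (y $ i) * osc Q g y z) \<le> (a i + (\<Sum>j\<in>UNIV. b i j)) * (?X * (1 + norm z))" for i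
    proof -
      have "norm (of_real (y $ i) * osc Q g y z) \<le> norm (osc Q (partial_deriv i g) y z) + (\<Sum>j\<in>UNIV. norm z * norm (osc Q (?lin i j) y z))"
        unfolding osc_integration_by_parts[OF Suc.prems]
      proof (intro norm_triangle_le_diff add_mono sum_norm_le)
        show "norm (of_real (z $ j) * osc Q (?lin i j) y z) \<le> norm z * norm (osc Q (?lin i j) y z)" for j
          unfolding norm_mult by (intro mult_right_mono) (auto simp: component_le_norm_cart)
      qed (simp add: norm_mult)
      then have "norm y ^ k * norm (of_real (y $ i) * osc Q g y z) \<le>
          norm y ^ k * (norm (osc Q (partial_deriv i g) y z) + (\<Sum>j\<in>UNIV. norm z * norm (osc Q (?lin i j) y z)))"
        by (intro mult_left_mono) auto
      also have "\<dots> = norm y ^ k * norm (osc Q (partial_deriv i g) y z) + (\<Sum>j\<in>UNIV. norm z * (norm y ^ k * norm (osc Q (?lin i j) y z)))"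
        by (simp add: distrib_left sum_distrib_left mult_ac)
      also have "\<dots> \<le> a i * ?X * (1 + norm z) + (\<Sum>j\<in>UNIV. (1 + norm z) * (b i j * ?X))"
      proof (rule add_mono)
        have "a i * ?X * 1 \<le> a i * ?X * (1 + norm z)" using a by (intro mult_left_mono) auto
        then show "norm y ^ k * norm (osc Q (partial_deriv i g) y z) \<le> a i * ?X * (1 + norm z)"
          using a(2)[of y i z] by simp
        show "(\<Sum>j\<in>UNIV. norm z * (norm y ^ k * norm (osc Q (?lin i j) y z))) \<le> (\<Sum>j\<in>UNIV. (1 + norm z) * (b i j * ?X))"
          by (intro sum_mono mult_mono[OF _ b(2)]) auto
      qed
      also have "\<dots> = (a i + (\<Sum>j\<in>UNIV. b i j)) * (?X * (1 + norm z))"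
        by (simp add: distrib_right sum_distrib_right sum_distrib_left mult_ac)
      finally show ?thesis .
    qed
    have "norm y ^ Suc k * norm (osc Q g y z) = norm y * (norm y ^ k * norm (osc Q g y z))" by simp
    also have "\<dots> \<le> (\<Sum>i\<in>UNIV. \<bar>y $ i\<bar>) * (norm y ^ k * norm (osc Q g y z))"
      by (intro mult_right_mono norm_le_l1_cart) auto
    also have "\<dots> = (\<Sum>i\<in>UNIV. norm y ^ k * norm (of_real (y $ i) * osc Q g y z))"
      unfolding sum_distrib_right by (intro sum.cong refl) (simp add: norm_mult)
    also have "\<dots> \<le> (\<Sum>i\<in>UNIV. (a i + (\<Sum>j\<in>UNIV. b i j)) * (?X * (1 + norm z)))"
      by (intro sum_mono step)
    also have "\<dots> = C * (?X * (1 + norm z) powr 1)"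
      by (simp add: C_def sum_distrib_right)
    also have "?X * (1 + norm z) powr 1 = (1 + norm z) powr (real (Suc k) - m / 2)"
      by (subst powr_add[symmetric]) (simp add: algebra_simps)
    finally show "norm y ^ Suc k * norm (osc Q g y z) \<le> C * (1 + norm z) powr (real (Suc k) - real (d_frak1 Q) / 2)"
      by (simp add: m_def)
  qed
qed

text \<open>If \<open>\<bar>y\<bar>\<close> is at most comparable to \<open>\<bar>z\<bar>\<close>, the decay in \<open>z\<close> suffices. Otherwise, with \<open>m = d_frak1 Q\<close>, trading \<open>m\<close>
factors gives \<open>\<bar>y\<bar> powr (- m) * (1 + \<bar>z\<bar>) powr (m / 2)\<close>, whose second factor is then controlled by \<open>\<bar>y\<bar>\<close>.\<close>

theorem osc_decay:
  assumes g: "test_function g"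
  shows "\<exists>C. \<forall>y z. norm (osc Q g y z) \<le> C * (1 + norm (y, z)) powr (- (real (d_frak1 Q) / 2))"
proof -
  define m where "m = d_frak1 Q"
  define r where "r = real m / 2"
  have r0: "r \<ge> 0" by (simp add: r_def)
  obtain C1 where C1: "C1 \<ge> 0" "\<And>y z. norm (osc Q g y z) \<le> C1 * (1 + norm z) powr (- r)"
    using osc_decay_in_normal_direction[OF g] unfolding r_def m_def by blast
  obtain C2 where C2: "C2 \<ge> 0" "\<And>y z. norm y ^ m * norm (osc Q g y z) \<le> C2 * (1 + norm z) powr (real m - r)"
    using osc_decay_in_tangential_direction[OF g, of m] unfolding r_def m_def by blast
  have key: "norm (osc Q g y z) \<le> (C1 + 2 ^ m * C2) * ((1 + norm (y, z)) / 2) powr (- r)" for y z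
  proof -
    have tri: "norm (y, z) \<le> norm y + norm z" by (rule norm_Pair_le)
    have nn: "(1 + norm (y, z)) / 2 > 0" by (intro divide_pos_pos add_pos_nonneg) auto
    show ?thesis
    proof (cases "norm y \<le> norm z \<or> norm y \<le> 1")
      case True
      then have "norm y \<le> 1 + norm z"
        by (rule disjE) (use norm_ge_zero[of z] in linarith)+
      then have "(1 + norm (y, z)) / 2 \<le> 1 + norm z" using tri by (simp add: field_simps)
      then have "(1 + norm z) powr (- r) \<le> ((1 + norm (y, z)) / 2) powr (- r)"
        using nn r0 by (intro powr_mono2') auto
      then have "C1 * (1 + norm z) powr (- r) \<le> (C1 + 2 ^ m * C2) * ((1 + norm (y, z)) / 2) powr (- r)"
        using C1 C2 by (intro mult_mono) auto
      then show ?thesis using C1(2)[of y z] by linarith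
    next
      case False
      then have y: "norm y > norm z" "norm y > 1" by auto
      let ?Y = "1 + norm y"
      have "?Y ^ m * norm (osc Q g y z) \<le> (2 * norm y) ^ m * norm (osc Q g y z)"
        using y by (intro mult_right_mono power_mono) auto
      also have "\<dots> = 2 ^ m * (norm y ^ m * norm (osc Q g y z))" by (simp add: power_mult_distrib)
      also have "\<dots> \<le> 2 ^ m * (C2 * (1 + norm z) powr (real m - r))" using C2(2) by (intro mult_left_mono) auto
      also have "\<dots> \<le> 2 ^ m * (C2 * ?Y powr (real m - r))"
        using C2(1) y by (intro mult_left_mono powr_mono2) (auto simp: r_def)
      also have "\<dots> = ?Y ^ m * (2 ^ m * C2 * ?Y powr (- r))"
      proof -
        have "?Y powr (real m - r) = ?Y powr real m * ?Y powr (- r)"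
          by (simp add: powr_add[symmetric])
        also have "?Y powr real m = ?Y ^ m" using y by (intro powr_realpow) simp
        finally show ?thesis by (simp only: mult_ac)
      qed
      finally have "norm (osc Q g y z) \<le> 2 ^ m * C2 * ?Y powr (- r)"
        using y by (subst (asm) mult_le_cancel_left_pos) auto
      also have "\<dots> \<le> (C1 + 2 ^ m * C2) * ((1 + norm (y, z)) / 2) powr (- r)"
        using C1 C2 nn r0 y tri by (intro mult_mono powr_mono2') auto
      finally show ?thesis .
    qed
  qed
  show ?thesis
  proof (intro exI[of _ "(C1 + 2 ^ m * C2) * 2 powr r"] allI)
    fix y :: "real ^ 'd" and z :: "real ^ 'n"
    have "((1 + norm (y, z)) / 2) powr (- r) = 2 powr r * (1 + norm (y, z)) powr (- r)"
      by (rule powr_minus_halved) (simp add: add_nonneg_nonneg)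
    then show "norm (osc Q g y z) \<le> (C1 + 2 ^ m * C2) * 2 powr r * (1 + norm (y, z)) powr (- (real (d_frak1 Q) / 2))"
      using key[of y z] by (simp add: r_def m_def mult.assoc)
  qed
qed

end

section \<open>Complex Gaussian integrals\<close>

text \<open>A primitive of \<open>exp (- z\<^sup>2)\<close> has the same limit along every line whose direction lies in the sector where
\<open>Re (z\<^sup>2)\<close> is positive: on the segment joining the two end points the integrand is of Gaussian size, while the
segment has length linear in \<open>R\<close>.\<close>

lemma exp_minus_square_primitive_shift:
  fixes \<beta> w :: complex
  assumes der: "\<And>z. (H has_field_derivative exp (- z\<^sup>2)) (at z)"
    and b1: "Re \<beta> > 0" and b2: "Re (\<beta>\<^sup>2) > 0"
  shows "((\<lambda>R. H (of_real R * \<beta> + w) - H (of_real R)) \<longlongrightarrow> 0) at_top"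
proof -
  \<comment> \<open>\<open>\<kappa>\<close> bounds \<open>Re (v\<^sup>2)\<close> from below for every \<open>v\<close> on the segment from 1 to \<open>\<beta>\<close>.\<close>
  define \<kappa> where "\<kappa> = min 1 (min (Re \<beta>) (Re (\<beta>\<^sup>2)))"
  have k: "\<kappa> > 0" "\<kappa> \<le> 1" "\<kappa> \<le> Re \<beta>" "\<kappa> \<le> Re (\<beta>\<^sup>2)" using b1 b2 by (auto simp: \<kappa>_def)
  define c where "c = 2 * (norm \<beta> + 1) * norm w"
  define d where "d = (norm w)\<^sup>2"
  define B where "B R = exp (- \<kappa> * R\<^sup>2 + c * R + d) * (R * norm (\<beta> - 1) + norm w)" for R
  have bound: "norm (H (of_real R * \<beta> + w) - H (of_real R)) \<le> B R" if R: "R > 0" for R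
  proof -
    let ?a = "of_real R :: complex" and ?b = "of_real R * \<beta> + w"
    have "norm (H ?b - H ?a) \<le> exp (- \<kappa> * R\<^sup>2 + c * R + d) * norm (?b - ?a)"
    proof (rule field_differentiable_bound[of "closed_segment ?a ?b" H "\<lambda>z. exp (- z\<^sup>2)"])
      fix z assume "z \<in> closed_segment ?a ?b"
      then obtain t where t: "0 \<le> t" "t \<le> 1" and z: "z = (1 - t) *\<^sub>R ?a + t *\<^sub>R ?b"
        by (auto simp: closed_segment_def)
      show "(H has_field_derivative exp (- z\<^sup>2)) (at z within closed_segment ?a ?b)"
        using der by (rule has_field_derivative_at_within)
      define v where "v = of_real (1 - t) + of_real t * \<beta>"
      have zv: "z = of_real R * v + of_real t * w"
        unfolding z v_def by (simp add: scaleR_conv_of_real algebra_simps)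
      have "Re (v\<^sup>2) = (1 - t)\<^sup>2 + 2 * (t * (1 - t)) * Re \<beta> + t\<^sup>2 * Re (\<beta>\<^sup>2)"
        unfolding v_def by (simp add: power2_eq_square algebra_simps)
      also have "\<dots> \<ge> (1 - t)\<^sup>2 * \<kappa> + 2 * (t * (1 - t)) * \<kappa> + t\<^sup>2 * \<kappa>"
        using k t by (intro add_mono mult_left_mono) (auto simp: mult_left_le)
      also have "(1 - t)\<^sup>2 * \<kappa> + 2 * (t * (1 - t)) * \<kappa> + t\<^sup>2 * \<kappa> = \<kappa>"
        by (simp add: power2_eq_square algebra_simps)
      finally have v2: "\<kappa> \<le> Re (v\<^sup>2)" .
      have "norm v \<le> (1 - t) + t * norm \<beta>"
        unfolding v_def using t by (intro norm_triangle_le) (auto simp: norm_mult simp del: of_real_diff)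
      also have "\<dots> \<le> 1 + norm \<beta>" using t by (intro add_mono mult_left_le_one_le) auto
      finally have nv: "norm v \<le> 1 + norm \<beta>" .
      have "z\<^sup>2 = of_real (R\<^sup>2) * v\<^sup>2 + (of_real (2 * R * t) * (v * w) + of_real (t\<^sup>2) * w\<^sup>2)"
        unfolding zv by (simp add: power2_eq_square algebra_simps)
      then have "Re (z\<^sup>2) = R\<^sup>2 * Re (v\<^sup>2) + Re (of_real (2 * R * t) * (v * w) + of_real (t\<^sup>2) * w\<^sup>2)"
        by simp
      moreover have "\<bar>Re (of_real (2 * R * t) * (v * w) + of_real (t\<^sup>2) * w\<^sup>2)\<bar> \<le> c * R + d"
      proof -
        have "norm (of_real (2 * R * t) * (v * w) + of_real (t\<^sup>2) * w\<^sup>2) \<le> (2 * R * t) * (norm v * norm w) + t\<^sup>2 * (norm w)\<^sup>2"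
          using R t by (intro norm_triangle_le) (simp add: norm_mult norm_power)
        also have "\<dots> \<le> (2 * R * 1) * ((1 + norm \<beta>) * norm w) + 1 * (norm w)\<^sup>2"
          using R t nv by (intro add_mono mult_mono) (auto simp: power_le_one)
        also have "\<dots> = c * R + d" by (simp add: c_def d_def)
        finally show ?thesis using abs_Re_le_cmod order_trans by blast
      qed
      moreover have "R\<^sup>2 * \<kappa> \<le> R\<^sup>2 * Re (v\<^sup>2)" using v2 by (intro mult_left_mono) auto
      ultimately have "- Re (z\<^sup>2) \<le> - \<kappa> * R\<^sup>2 + c * R + d" by (simp add: mult.commute)
      then show "norm (exp (- z\<^sup>2)) \<le> exp (- \<kappa> * R\<^sup>2 + c * R + d)"
        by (simp add: norm_exp_eq_Re)
    qed auto
    also have "norm (?b - ?a) \<le> R * norm (\<beta> - 1) + norm w"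
    proof -
      have "?b - ?a = of_real R * (\<beta> - 1) + w" by (simp add: algebra_simps)
      then have "norm (?b - ?a) \<le> norm (of_real R * (\<beta> - 1)) + norm w" by (simp only: norm_triangle_ineq)
      then show ?thesis using R by (simp add: norm_mult)
    qed
    finally show ?thesis unfolding B_def by simp
  qed
  have "(B \<longlongrightarrow> 0) at_top"
    unfolding B_def using k(1) by real_asymp
  then show ?thesis
    by (rule Lim_null_comparison[rotated]) (auto intro!: eventually_at_top_dense[THEN iffD2] exI[of _ 0] bound)
qed

lemma integrable_exp_minus_square_complex:
  fixes \<beta> w :: complex
  assumes b2: "Re (\<beta>\<^sup>2) > 0"
  shows "integrable lborel (\<lambda>r::real. exp (- (of_real r * \<beta> + w)\<^sup>2))"
proof -
  define a where "a = Re (\<beta>\<^sup>2)"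
  define e where "e = 2 * Re (\<beta> * w)"
  define c where "c = e / a"
  define \<sigma> where "\<sigma> = sqrt (1 / (2 * a))"
  have a: "a > 0" using b2 by (simp add: a_def)
  have s: "\<sigma> > 0" "\<sigma>\<^sup>2 = 1 / (2 * a)" using a by (auto simp: \<sigma>_def)
  define M where "M = sqrt (2 * pi * \<sigma>\<^sup>2) * exp (a * (c / 2)\<^sup>2 - Re (w\<^sup>2))"
  \<comment> \<open>Completing the square in \<open>r\<close>, the modulus is a multiple of a normal density.\<close>
  have eq: "norm (exp (- (of_real r * \<beta> + w)\<^sup>2)) = M * normal_density (- c / 2) \<sigma> r" for r :: real
  proof -
    have "Re ((of_real r * \<beta> + w)\<^sup>2) = r\<^sup>2 * a + r * (a * c) + Re (w\<^sup>2)"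
    proof -
      have "a * c = e" using a by (simp add: c_def)
      moreover have "Re ((of_real r * \<beta> + w)\<^sup>2) = r\<^sup>2 * a + r * e + Re (w\<^sup>2)"
        by (simp add: a_def e_def power2_eq_square algebra_simps)
      ultimately show ?thesis by simp
    qed
    then have n: "norm (exp (- (of_real r * \<beta> + w)\<^sup>2)) = exp (- (r\<^sup>2 * a + r * (a * c) + Re (w\<^sup>2)))"
      by (simp add: norm_exp_eq_Re)
    have "- (r - - c / 2)\<^sup>2 / (2 * \<sigma>\<^sup>2) = - a * (r + c / 2)\<^sup>2"
      using a by (simp add: s)
    then have "normal_density (- c / 2) \<sigma> r = exp (- a * (r + c / 2)\<^sup>2) / sqrt (2 * pi * \<sigma>\<^sup>2)"
      by (simp add: normal_density_def)
    moreover have "sqrt (2 * pi * \<sigma>\<^sup>2) \<noteq> 0" using s a by simp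
    ultimately have "M * normal_density (- c / 2) \<sigma> r = exp (a * (c / 2)\<^sup>2 - Re (w\<^sup>2)) * exp (- a * (r + c / 2)\<^sup>2)"
      unfolding M_def by simp
    also have "\<dots> = exp (- (r\<^sup>2 * a + r * (a * c) + Re (w\<^sup>2)))"
      unfolding exp_add[symmetric] by (rule arg_cong[where f = exp]) (simp add: power2_eq_square algebra_simps)
    finally show ?thesis using n by simp
  qed
  show ?thesis
  proof (rule Bochner_Integration.integrable_bound)
    show "integrable lborel (\<lambda>r. M * normal_density (- c / 2) \<sigma> r)"
      using s by (intro integrable_mult_right) (simp add: integrable_normal_density)
    show "AE r in lborel. norm (exp (- (of_real r * \<beta> + w)\<^sup>2)) \<le> norm (M * normal_density (- c / 2) \<sigma> r)"
      using eq s by (auto simp: M_def)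
  qed (auto intro!: borel_measurable_continuous_onI continuous_intros)
qed

lemma integral_tendsto_symmetric:
  fixes f :: "real \<Rightarrow> complex"
  assumes "integrable lborel f"
  shows "((\<lambda>R. LINT x|lborel. indicator {-R..R} x *\<^sub>R f x) \<longlongrightarrow> (LINT x|lborel. f x)) at_top"
proof (rule integral_dominated_convergence_at_top[where w = "\<lambda>x. norm (f x)"])
  show "AE x in lborel. ((\<lambda>R. indicat_real {-R..R} x *\<^sub>R f x) \<longlongrightarrow> f x) at_top"
  proof (rule AE_I2)
    fix x :: real
    have "eventually (\<lambda>R. indicat_real {-R..R} x *\<^sub>R f x = f x) at_top"
      using eventually_ge_at_top[of "\<bar>x\<bar>"] by eventually_elim (auto simp: indicator_def)
    then show "((\<lambda>R. indicat_real {-R..R} x *\<^sub>R f x) \<longlongrightarrow> f x) at_top" by (rule tendsto_eventually)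
  qed
  show "eventually (\<lambda>R. AE x in lborel. norm (indicat_real {-R..R} x *\<^sub>R f x) \<le> norm (f x)) at_top"
    by (auto simp: indicator_def)
qed (use assms in \<open>auto simp: borel_measurable_integrable\<close>)

text \<open>Truncated to \<open>[-R, R]\<close>, both sides are differences of a primitive of \<open>exp (- z\<^sup>2)\<close>, at the ends of a rotated
and shifted segment and at \<open>\<plusminus>R\<close> respectively; these agree in the limit. The real Gaussian integral supplies the
value.\<close>

theorem complex_gaussian_integral:
  fixes \<beta> w :: complex
  assumes b1: "Re \<beta> > 0" and b2: "Re (\<beta>\<^sup>2) > 0"
  shows "\<beta> * (LINT r|lborel. exp (- (of_real r * \<beta> + w)\<^sup>2)) = of_real (sqrt pi)"
proof -
  have "(\<lambda>z::complex. exp (- z\<^sup>2)) holomorphic_on UNIV" by (intro holomorphic_intros)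
  then obtain H :: "complex \<Rightarrow> complex" where H: "\<And>z. (H has_field_derivative exp (- z\<^sup>2)) (at z)"
    using holomorphic_convex_primitive'[OF convex_UNIV open_UNIV] by auto
  \<comment> \<open>The reflected function is a primitive too, which treats the left end point like the right one.\<close>
  have odd: "((\<lambda>z. - H (- z)) has_field_derivative exp (- z\<^sup>2)) (at z)" for z
  proof -
    have "(uminus has_field_derivative -1) (at z)" by (auto intro!: derivative_eq_intros)
    from DERIV_chain2[where f = H and g = uminus, OF H this] show ?thesis
      by (auto intro!: derivative_eq_intros)
  qed
  define \<Delta> where "\<Delta> R = H (of_real R) - H (- of_real R)" for R :: real
  have lim: "((\<lambda>R. \<beta> * (LINT r|lborel. indicat_real {-R..R} r *\<^sub>R exp (- (of_real r * \<beta> + w)\<^sup>2)) - \<Delta> R) \<longlongrightarrow> 0) at_top"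
    if b: "Re \<beta> > 0" "Re (\<beta>\<^sup>2) > 0" for \<beta> w :: complex
  proof -
    have "((\<lambda>R. (H (of_real R * \<beta> + w) - H (of_real R)) + ((- H (- (of_real R * \<beta> + (- w)))) - (- H (- of_real R)))) \<longlongrightarrow> 0 + 0) at_top"
      by (intro tendsto_add exp_minus_square_primitive_shift[OF H b] exp_minus_square_primitive_shift[OF odd b])
    moreover have "eventually (\<lambda>R. (H (of_real R * \<beta> + w) - H (of_real R)) + ((- H (- (of_real R * \<beta> + (- w)))) - (- H (- of_real R)))
      = \<beta> * (LINT r|lborel. indicat_real {-R..R} r *\<^sub>R exp (- (of_real r * \<beta> + w)\<^sup>2)) - \<Delta> R) at_top"
      using eventually_gt_at_top[of 0]
    proof eventually_elim
      case (elim R)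
      have bn: "\<beta> \<noteq> 0" using b by auto
      have "((\<lambda>z. H (z * \<beta> + w) / \<beta>) has_field_derivative exp (- (of_real r * \<beta> + w)\<^sup>2)) (at (of_real r))" for r :: real
      proof -
        have "((\<lambda>z. z * \<beta> + w) has_field_derivative \<beta>) (at (of_real r))"
          by (auto intro!: derivative_eq_intros)
        from DERIV_cdivide[OF DERIV_chain2[where f = H, OF H this], of \<beta>] bn show ?thesis by simp
      qed
      from has_vector_derivative_real_field[OF this]
      have "((\<lambda>r. H (of_real r * \<beta> + w) / \<beta>) has_vector_derivative exp (- (of_real r * \<beta> + w)\<^sup>2)) (at r within {-R..R})" for r
        by (rule has_vector_derivative_at_within)
      then have "(LINT r|lborel. indicat_real {-R..R} r *\<^sub>R exp (- (of_real r * \<beta> + w)\<^sup>2)) =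
          H (of_real R * \<beta> + w) / \<beta> - H (of_real (- R) * \<beta> + w) / \<beta>"
        using elim by (intro integral_FTC_Icc) (auto intro!: continuous_intros)
      then show ?case using bn by (simp add: \<Delta>_def field_simps)
    qed
    ultimately show ?thesis by (simp add: tendsto_cong)
  qed
  have one: "(\<Delta> \<longlongrightarrow> of_real (sqrt pi)) at_top"
  proof -
    have i1: "integrable lborel (\<lambda>r::real. exp (- (of_real r * 1 + 0 :: complex)\<^sup>2))"
      by (rule integrable_exp_minus_square_complex) simp
    have "(LINT r|lborel. exp (- (of_real r * 1 + 0 :: complex)\<^sup>2)) = of_real (LINT r|lborel. exp (- (r::real)\<^sup>2))"
    proof -
      have "exp (- (of_real r * 1 + 0 :: complex)\<^sup>2) = of_real (exp (- r\<^sup>2))" for r :: real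
        by (simp flip: exp_of_real)
      then show ?thesis by (simp only: integral_complex_of_real)
    qed
    also have "(LINT r|lborel. exp (- (r::real)\<^sup>2)) = sqrt pi"
    proof -
      have "has_bochner_integral lborel (\<lambda>x::real. exp (- x\<^sup>2)) (2 *\<^sub>R (sqrt pi / 2))"
        by (rule has_bochner_integral_even_function[OF gaussian_moment_0]) simp
      then show ?thesis by (simp add: has_bochner_integral_iff)
    qed
    finally have v: "(LINT r|lborel. exp (- (of_real r * 1 + 0 :: complex)\<^sup>2)) = of_real (sqrt pi)" .
    have "((\<lambda>R. 1 * (LINT r|lborel. indicat_real {-R..R} r *\<^sub>R exp (- (of_real r * 1 + 0 :: complex)\<^sup>2)) -
       (1 * (LINT r|lborel. indicat_real {-R..R} r *\<^sub>R exp (- (of_real r * 1 + 0 :: complex)\<^sup>2)) - \<Delta> R)) \<longlongrightarrow> 1 * of_real (sqrt pi) - 0) at_top"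
      by (intro tendsto_diff tendsto_mult tendsto_const lim[of 1 0] integral_tendsto_symmetric[OF i1, unfolded v]) auto
    then show ?thesis by simp
  qed
  have "((\<lambda>R. \<beta> * (LINT r|lborel. indicat_real {-R..R} r *\<^sub>R exp (- (of_real r * \<beta> + w)\<^sup>2)) - \<Delta> R)
     \<longlongrightarrow> \<beta> * (LINT r|lborel. exp (- (of_real r * \<beta> + w)\<^sup>2)) - of_real (sqrt pi)) at_top"
    by (intro tendsto_diff tendsto_mult tendsto_const one integral_tendsto_symmetric integrable_exp_minus_square_complex b2)
  from tendsto_unique[OF _ this lim[OF b1 b2]] show ?thesis by simp
qed

section \<open>Gaussians as averages of characters\<close>

text \<open>The Fourier transform of a complex Gaussian is a complex Gaussian. The total mass \<open>sqrt (\<bar>p\<bar> / Re p)\<close> of the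
averaging density is what the optimality of the decay rests on: it is 1 for real \<open>p\<close>, and grows only like the
square root of the imaginary part.\<close>

lemma gaussian_as_average_of_characters:
  fixes p :: complex
  assumes p: "Re p > 0"
  obtains g :: "real \<Rightarrow> complex" where "integrable lborel g"
    "(LINT r|lborel. norm (g r)) = sqrt (norm p / Re p)"
    "\<And>s. (LINT r|lborel. exp (\<i> * of_real (r * s)) * g r) = exp (- p * of_real (s\<^sup>2))"
proof -
  define q where "q = csqrt p"
  have q2: "q\<^sup>2 = p" by (simp add: q_def)
  have p0: "p \<noteq> 0" using p by auto
  have q0: "q \<noteq> 0" using p0 q2 by auto
  have "Re q \<noteq> 0"
  proof
    assume "Re q = 0"
    then have "Re (q\<^sup>2) \<le> 0" by (simp add: power2_eq_square)
    then show False using p q2 by simp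
  qed
  moreover have "Re q \<ge> 0" using p norm_ge_zero[of p] by (simp add: q_def)
  ultimately have rq: "Re q > 0" by simp
  \<comment> \<open>With this choice \<open>\<beta>\<^sup>2 = 1 / (4 p)\<close>, the exponent of the transformed Gaussian.\<close>
  define \<beta> where "\<beta> = 1 / (2 * q)"
  define a where "a = Re (\<beta>\<^sup>2)"
  have b2: "\<beta>\<^sup>2 = 1 / (4 * p)" by (simp add: \<beta>_def power_divide power_mult_distrib q2)
  have a: "a = Re p / (4 * (norm p)\<^sup>2)"
  proof -
    have "(4 * Re p)\<^sup>2 + (4 * Im p)\<^sup>2 = 16 * (norm p)\<^sup>2"
      by (simp add: cmod_power2 power_mult_distrib)
    then show ?thesis unfolding a_def b2 by (simp add: Re_divide power_mult_distrib)
  qed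
  have a0: "a > 0" unfolding a using p p0 by simp
  have b1: "Re \<beta> > 0" unfolding \<beta>_def using rq
    by (simp add: Re_divide) (intro divide_pos_pos add_pos_nonneg; simp)
  define g where "g r = (\<beta> / of_real (sqrt pi)) * exp (- (of_real r * \<beta> + 0)\<^sup>2)" for r :: real
  have int_g: "integrable lborel g"
    unfolding g_def using a0 by (intro integrable_mult_right integrable_exp_minus_square_complex) (simp add: a_def)
  have fourier: "(LINT r|lborel. exp (\<i> * of_real (r * s)) * g r) = exp (- p * of_real (s\<^sup>2))" for s
  proof -
    \<comment> \<open>The shift that turns the square \<open>(r \<beta> + w)\<^sup>2\<close> into the character times the Gaussian in \<open>s\<close>.\<close>
    define w where "w = - \<i> * of_real s * q"
    have bw: "2 * \<beta> * w = - \<i> * of_real s" using q0 by (simp add: \<beta>_def w_def)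
    have w2: "w\<^sup>2 = - p * of_real (s\<^sup>2)" by (simp add: w_def power_mult_distrib q2)
    have "exp (\<i> * of_real (r * s)) * g r
        = (exp (- p * of_real (s\<^sup>2)) * \<beta> / of_real (sqrt pi)) * exp (- (of_real r * \<beta> + w)\<^sup>2)" for r
    proof -
      have "(of_real r * \<beta> + w)\<^sup>2 = (of_real r * \<beta>)\<^sup>2 + of_real r * (2 * \<beta> * w) + w\<^sup>2"
        by (simp add: power2_eq_square algebra_simps)
      then have "exp (- p * of_real (s\<^sup>2)) * exp (- (of_real r * \<beta> + w)\<^sup>2) = exp (\<i> * of_real (r * s)) * exp (- (of_real r * \<beta> + 0)\<^sup>2)"
        unfolding exp_add[symmetric] bw w2 by (intro arg_cong[where f = exp]) (simp add: algebra_simps)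
      then show ?thesis unfolding g_def by (simp add: mult_ac)
    qed
    then have "(LINT r|lborel. exp (\<i> * of_real (r * s)) * g r)
       = exp (- p * of_real (s\<^sup>2)) / of_real (sqrt pi) * (\<beta> * (LINT r|lborel. exp (- (of_real r * \<beta> + w)\<^sup>2)))"
      by (simp add: mult_ac)
    also have "\<dots> = exp (- p * of_real (s\<^sup>2))"
      using complex_gaussian_integral[OF b1, of w] a0 by (simp add: a_def)
    finally show ?thesis .
  qed
  have nb: "norm \<beta> = 1 / (2 * sqrt (norm p))"
    using q2 by (simp add: \<beta>_def norm_divide norm_mult q_def)
  have "(LINT r|lborel. norm (g r)) = (LINT r|lborel. norm \<beta> / sqrt pi * sqrt (pi / a) * normal_density 0 (sqrt (1 / (2 * a))) r)"
  proof (intro Bochner_Integration.integral_cong refl)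
    fix r
    have "norm (g r) = norm \<beta> / sqrt pi * exp (- (r\<^sup>2 * a))"
      unfolding g_def by (simp add: norm_mult norm_divide norm_exp_eq_Re power_mult_distrib a_def)
    moreover have "normal_density 0 (sqrt (1 / (2 * a))) r = exp (- (r\<^sup>2 * a)) / sqrt (pi / a)"
      using a0 by (simp add: normal_density_def mult_ac)
    moreover have "sqrt (pi / a) \<noteq> 0" using a0 by simp
    ultimately show "norm (g r) = norm \<beta> / sqrt pi * sqrt (pi / a) * normal_density 0 (sqrt (1 / (2 * a))) r"
      by simp
  qed
  also have "\<dots> = norm \<beta> / sqrt pi * sqrt (pi / a)"
    using a0 by (simp add: integral_normal_density)
  also have "\<dots> = norm \<beta> / sqrt a" by (simp add: real_sqrt_divide)
  also have "\<dots> = sqrt (1 / (4 * norm p * a))"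
    by (simp add: nb real_sqrt_divide real_sqrt_mult)
  also have "1 / (4 * norm p * a) = norm p / Re p"
    unfolding a using p0 p by (simp add: power2_eq_square)
  finally show thesis using that int_g fourier by blast
qed

text \<open>Since the Gaussian is an average of characters, multiplying by it averages the Fourier transform over
translates, so the supremum grows at most by the mass of the average.\<close>

lemma gaussian_multiplier_bound:
  fixes f :: "real ^ 'd \<Rightarrow> complex"
  assumes p: "Re p > 0" and f: "integrable lborel f"
    and D: "\<And>y. norm (LINT \<xi>|lborel. exp (\<i> * of_real (y \<bullet> \<xi>)) * f \<xi>) \<le> D"
  shows "integrable lborel (\<lambda>\<xi>. f \<xi> * exp (- p * of_real ((u \<bullet> \<xi> - s)\<^sup>2)))"
    and "norm (LINT \<xi>|lborel. exp (\<i> * of_real (y \<bullet> \<xi>)) * (f \<xi> * exp (- p * of_real ((u \<bullet> \<xi> - s)\<^sup>2))))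
      \<le> D * sqrt (norm p / Re p)"
proof -
  have [measurable]: "f \<in> borel_measurable borel" using f by simp
  show "integrable lborel (\<lambda>\<xi>. f \<xi> * exp (- p * of_real ((u \<bullet> \<xi> - s)\<^sup>2)))"
  proof (rule Bochner_Integration.integrable_bound[OF f])
    have "norm (f \<xi> * exp (- p * of_real ((u \<bullet> \<xi> - s)\<^sup>2))) \<le> norm (f \<xi>)" for \<xi>
      using p by (simp add: norm_mult norm_exp_eq_Re mult_right_le_one_le)
    then show "AE \<xi> in lborel. norm (f \<xi> * exp (- p * of_real ((u \<bullet> \<xi> - s)\<^sup>2))) \<le> norm (f \<xi>)" by simp
  qed simp
  obtain g :: "real \<Rightarrow> complex" where g: "integrable lborel g"
    "(LINT r|lborel. norm (g r)) = sqrt (norm p / Re p)"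
    "\<And>s. (LINT r|lborel. exp (\<i> * of_real (r * s)) * g r) = exp (- p * of_real (s\<^sup>2))"
    using gaussian_as_average_of_characters[OF p] by blast
  have [measurable]: "g \<in> borel_measurable borel" using g by simp
  define F where "F \<xi> r = exp (\<i> * of_real (y \<bullet> \<xi>)) * f \<xi> * (exp (\<i> * of_real (r * (u \<bullet> \<xi> - s))) * g r)" for \<xi> r
  have nF: "norm (F \<xi> r) = norm (f \<xi>) * norm (g r)" for \<xi> r
    by (simp add: F_def norm_mult norm_exp_eq_Re)
  have mF[measurable]: "case_prod F \<in> borel_measurable (lborel \<Otimes>\<^sub>M lborel)"
    unfolding F_def by measurable
  have int_F: "integrable (lborel \<Otimes>\<^sub>M lborel) (case_prod F)"
  proof (rule lborel_pair.Fubini_integrable)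
    show "integrable lborel (\<lambda>\<xi>. LINT r|lborel. norm (case_prod F (\<xi>, r)))"
      using f by (simp add: nF)
    show "AE \<xi> in lborel. integrable lborel (\<lambda>r. case_prod F (\<xi>, r))"
    proof (rule AE_I2)
      fix \<xi>
      show "integrable lborel (\<lambda>r. case_prod F (\<xi>, r))"
      proof (rule Bochner_Integration.integrable_bound)
        show "integrable lborel (\<lambda>r. norm (f \<xi>) * norm (g r))" using g by simp
        show "(\<lambda>r. case_prod F (\<xi>, r)) \<in> borel_measurable lborel" unfolding F_def by simp
      qed (simp add: nF)
    qed
  qed simp
  have "(LINT \<xi>|lborel. exp (\<i> * of_real (y \<bullet> \<xi>)) * (f \<xi> * exp (- p * of_real ((u \<bullet> \<xi> - s)\<^sup>2))))
      = (LINT \<xi>|lborel. LINT r|lborel. F \<xi> r)"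
  proof (intro Bochner_Integration.integral_cong refl)
    fix \<xi>
    have "(LINT r|lborel. F \<xi> r) = exp (\<i> * of_real (y \<bullet> \<xi>)) * f \<xi> * (LINT r|lborel. exp (\<i> * of_real (r * (u \<bullet> \<xi> - s))) * g r)"
      unfolding F_def by (rule integral_mult_right_zero)
    then show "exp (\<i> * of_real (y \<bullet> \<xi>)) * (f \<xi> * exp (- p * of_real ((u \<bullet> \<xi> - s)\<^sup>2))) = (LINT r|lborel. F \<xi> r)"
      unfolding g(3) by (simp only: mult.assoc)
  qed
  also have "\<dots> = (LINT r|lborel. LINT \<xi>|lborel. F \<xi> r)"
    by (rule lborel_pair.Fubini_integral[symmetric]) (rule int_F)
  also have "\<dots> = (LINT r|lborel. exp (- \<i> * of_real (r * s)) * g r * (LINT \<xi>|lborel. exp (\<i> * of_real ((y + r *\<^sub>R u) \<bullet> \<xi>)) * f \<xi>))"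
  proof (intro Bochner_Integration.integral_cong refl)
    fix r
    have "F \<xi> r = exp (- \<i> * of_real (r * s)) * g r * (exp (\<i> * of_real ((y + r *\<^sub>R u) \<bullet> \<xi>)) * f \<xi>)" for \<xi>
    proof -
      have "exp (\<i> * of_real (y \<bullet> \<xi>)) * exp (\<i> * of_real (r * (u \<bullet> \<xi> - s)))
         = exp (- \<i> * of_real (r * s)) * exp (\<i> * of_real ((y + r *\<^sub>R u) \<bullet> \<xi>))"
        unfolding exp_add[symmetric] by (intro arg_cong[where f = exp]) (simp add: inner_add_left algebra_simps)
      then show ?thesis unfolding F_def by (simp add: mult_ac)
    qed
    then show "(LINT \<xi>|lborel. F \<xi> r) = exp (- \<i> * of_real (r * s)) * g r * (LINT \<xi>|lborel. exp (\<i> * of_real ((y + r *\<^sub>R u) \<bullet> \<xi>)) * f \<xi>)"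
      by simp
  qed
  finally have eq: "(LINT \<xi>|lborel. exp (\<i> * of_real (y \<bullet> \<xi>)) * (f \<xi> * exp (- p * of_real ((u \<bullet> \<xi> - s)\<^sup>2))))
      = (LINT r|lborel. exp (- \<i> * of_real (r * s)) * g r * (LINT \<xi>|lborel. exp (\<i> * of_real ((y + r *\<^sub>R u) \<bullet> \<xi>)) * f \<xi>))" .
  let ?G = "\<lambda>r. exp (- \<i> * of_real (r * s)) * g r * (LINT \<xi>|lborel. exp (\<i> * of_real ((y + r *\<^sub>R u) \<bullet> \<xi>)) * f \<xi>)"
  have D0: "D \<ge> 0" using D[of 0] norm_ge_zero order_trans by blast
  have "norm (?G r) \<le> D * norm (g r)" for r
    using mult_left_mono[OF D[of "y + r *\<^sub>R u"], of "norm (g r)"] by (simp add: norm_mult norm_exp_eq_Re mult_ac)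
  then have "norm (integral\<^sup>L lborel ?G) \<le> (LINT r|lborel. D * norm (g r))"
    using g(1) D0 by (intro Bochner_Integration.integral_norm_bound_integral order_trans[OF integral_norm_bound] integral_mono') auto
  then show "norm (LINT \<xi>|lborel. exp (\<i> * of_real (y \<bullet> \<xi>)) * (f \<xi> * exp (- p * of_real ((u \<bullet> \<xi> - s)\<^sup>2))))
      \<le> D * sqrt (norm p / Re p)"
    unfolding eq by (simp add: g(2))
qed

lemma gaussian_product_multiplier_bound:
  fixes f :: "real ^ 'd \<Rightarrow> complex" and u :: "'k \<Rightarrow> real ^ 'd"
  assumes "finite S" and p: "\<And>j. j \<in> S \<Longrightarrow> Re (p j) > 0" and f: "integrable lborel f"
    and D: "\<And>y. norm (LINT \<xi>|lborel. exp (\<i> * of_real (y \<bullet> \<xi>)) * f \<xi>) \<le> D"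
  shows "integrable lborel (\<lambda>\<xi>. f \<xi> * (\<Prod>j\<in>S. exp (- p j * of_real ((u j \<bullet> \<xi> - s j)\<^sup>2)))) \<and>
    (\<forall>y. norm (LINT \<xi>|lborel. exp (\<i> * of_real (y \<bullet> \<xi>)) * (f \<xi> * (\<Prod>j\<in>S. exp (- p j * of_real ((u j \<bullet> \<xi> - s j)\<^sup>2)))))
      \<le> D * (\<Prod>j\<in>S. sqrt (norm (p j) / Re (p j))))"
  using assms(1) p
proof (induction S rule: finite_induct)
  case empty
  then show ?case using f D by simp
next
  case (insert k S)
  let ?f = "\<lambda>\<xi>. f \<xi> * (\<Prod>j\<in>S. exp (- p j * of_real ((u j \<bullet> \<xi> - s j)\<^sup>2)))"
  have IH: "integrable lborel ?f" "\<And>y. norm (LINT \<xi>|lborel. exp (\<i> * of_real (y \<bullet> \<xi>)) * ?f \<xi>) \<le> D * (\<Prod>j\<in>S. sqrt (norm (p j) / Re (p j)))"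
    using insert.IH insert.prems by auto
  have pk: "Re (p k) > 0" using insert.prems by simp
  have eq: "f \<xi> * (\<Prod>j\<in>insert k S. exp (- p j * of_real ((u j \<bullet> \<xi> - s j)\<^sup>2))) = ?f \<xi> * exp (- p k * of_real ((u k \<bullet> \<xi> - s k)\<^sup>2))" for \<xi>
    using insert.hyps by (simp add: mult_ac)
  have eq2: "D * (\<Prod>j\<in>insert k S. sqrt (norm (p j) / Re (p j))) = D * (\<Prod>j\<in>S. sqrt (norm (p j) / Re (p j))) * sqrt (norm (p k) / Re (p k))"
    using insert.hyps by (simp add: mult_ac)
  show ?case
    unfolding eq eq2 using gaussian_multiplier_bound[OF pk IH, where u = "u k" and s = "s k"] by blast
qed

section \<open>Optimality of the decay\<close>

text \<open>As \<open>a\<close> grows the Gaussian concentrates at \<open>\<xi>0\<close>. If the value there were nonzero, then after normalisation the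
contribution of the ball of radius \<open>d / 2\<close> would be of order \<open>exp (- a (d / 2)\<^sup>2)\<close>, whereas everything outside the
ball of radius \<open>d\<close> contributes only \<open>exp (- a d\<^sup>2)\<close>.\<close>

lemma gaussian_means_determine_value:
  fixes f :: "'a::euclidean_space \<Rightarrow> complex"
  assumes f: "integrable lborel f" "continuous_on UNIV f"
    and zero: "\<And>a. a > 0 \<Longrightarrow> (LINT \<xi>|lborel. f \<xi> * of_real (exp (- a * (norm (\<xi> - \<xi>0))\<^sup>2))) = 0"
  shows "f \<xi>0 = 0"
proof (rule ccontr)
  assume nz: "f \<xi>0 \<noteq> 0"
  define g where "g \<xi> = Re (f \<xi> / f \<xi>0)" for \<xi>
  have ig: "integrable lborel g" unfolding g_def by (intro integrable_Re integrable_divide f)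
  have cg: "continuous_on UNIV g" unfolding g_def using nz by (intro continuous_intros f) auto
  have [measurable]: "g \<in> borel_measurable borel" using cg by (rule borel_measurable_continuous_onI)
  have g1: "g \<xi>0 = 1" using nz by (simp add: g_def)
  obtain d where d: "d > 0" "\<And>\<xi>. dist \<xi> \<xi>0 < d \<Longrightarrow> g \<xi> > 1 / 2"
  proof -
    have "isCont g \<xi>0" using cg by (simp add: continuous_on_eq_continuous_at)
    then have "(g \<longlongrightarrow> g \<xi>0) (nhds \<xi>0)"
      by (simp only: isCont_def tendsto_at_iff_tendsto_nhds)
    then have "eventually (\<lambda>\<xi>. g \<xi> > 1 / 2) (nhds \<xi>0)"
      by (rule order_tendstoD) (simp add: g1)
    then show ?thesis using that unfolding eventually_nhds_metric by blast
  qed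
  define w where "w a \<xi> = exp (- a * (norm (\<xi> - \<xi>0))\<^sup>2)" for a \<xi>
  define G where "G = (LINT \<xi>|lborel. \<bar>g \<xi>\<bar>)"
  define V where "V = measure lborel (ball \<xi>0 (d / 2))"
  have V: "V > 0" unfolding V_def using d by (intro content_ball_pos) auto
  have ineq: "V / 2 \<le> exp (- (3 / 4) * d\<^sup>2 * a) * G" if a: "a > 0" for a
  proof -
    have w1: "0 \<le> w a \<xi>" "w a \<xi> \<le> 1" for \<xi> using a by (auto simp: w_def)
    have [measurable]: "w a \<in> borel_measurable borel"
      unfolding w_def by (intro borel_measurable_continuous_onI continuous_intros)
    have igw: "integrable lborel (\<lambda>\<xi>. g \<xi> * w a \<xi>)"
      by (rule Bochner_Integration.integrable_bound[OF ig]) (use w1 in \<open>auto simp: abs_mult mult_left_le\<close>)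
    have "(LINT \<xi>|lborel. g \<xi> * w a \<xi>) = Re (LINT \<xi>|lborel. f \<xi> * of_real (w a \<xi>) / f \<xi>0)"
    proof -
      have ifw: "integrable lborel (\<lambda>\<xi>. f \<xi> * of_real (w a \<xi>) / f \<xi>0)"
      proof (intro integrable_divide Bochner_Integration.integrable_bound[OF f(1)])
        have [measurable]: "f \<in> borel_measurable borel" using f(2) by (rule borel_measurable_continuous_onI)
        show "(\<lambda>\<xi>. f \<xi> * of_real (w a \<xi>)) \<in> borel_measurable lborel" by simp
        show "AE \<xi> in lborel. norm (f \<xi> * of_real (w a \<xi>)) \<le> norm (f \<xi>)"
          using w1 by (simp add: norm_mult mult_left_le)
      qed
      have "g \<xi> * w a \<xi> = Re (f \<xi> * of_real (w a \<xi>) / f \<xi>0)" for \<xi>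
      proof -
        have "f \<xi> * of_real (w a \<xi>) / f \<xi>0 = (f \<xi> / f \<xi>0) * of_real (w a \<xi>)" by simp
        then show ?thesis
          by (simp only: g_def times_complex.sel Re_complex_of_real Im_complex_of_real mult_zero_right diff_zero)
      qed
      then show ?thesis using ifw by (simp only: integral_Re)
    qed
    also have "\<dots> = 0" using zero[OF a] by (simp add: w_def)
    finally have z: "(LINT \<xi>|lborel. g \<xi> * w a \<xi>) = 0" .
    \<comment> \<open>A lower bound for the integrand: inside the ball of radius \<open>d\<close> the real part of \<open>f \<xi> / f \<xi>0\<close> exceeds 1/2.\<close>
    let ?lo = "\<lambda>\<xi>. 1 / 2 * exp (- a * (d / 2)\<^sup>2) * indicat_real (ball \<xi>0 (d / 2)) \<xi> - exp (- a * d\<^sup>2) * \<bar>g \<xi>\<bar>"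
    have ib: "integrable lborel (indicat_real (ball \<xi>0 (d / 2)))"
      using emeasure_lborel_ball_finite[of \<xi>0 "d/2"] by (simp add: integrable_indicator_iff)
    have "(LINT \<xi>|lborel. ?lo \<xi>) \<le> (LINT \<xi>|lborel. g \<xi> * w a \<xi>)"
    proof (rule integral_mono)
      show "integrable lborel ?lo" using ib ig by (intro Bochner_Integration.integrable_diff integrable_mult_right integrable_abs)
      show "integrable lborel (\<lambda>\<xi>. g \<xi> * w a \<xi>)" by (rule igw)
      fix \<xi>
      show "?lo \<xi> \<le> g \<xi> * w a \<xi>"
      proof (cases "dist \<xi> \<xi>0 < d")
        case True
        have "1 / 2 * exp (- a * (d / 2)\<^sup>2) * indicat_real (ball \<xi>0 (d / 2)) \<xi> \<le> g \<xi> * w a \<xi>"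
        proof (cases "\<xi> \<in> ball \<xi>0 (d / 2)")
          case t: True
          then have "norm (\<xi> - \<xi>0) \<le> d / 2" by (simp add: dist_norm norm_minus_commute)
          then have "(norm (\<xi> - \<xi>0))\<^sup>2 \<le> (d / 2)\<^sup>2" by (intro power_mono) auto
          then have "exp (- a * (d / 2)\<^sup>2) \<le> w a \<xi>" unfolding w_def using a by simp
          then have "1 / 2 * exp (- a * (d / 2)\<^sup>2) \<le> g \<xi> * w a \<xi>"
            using d(2)[OF True] by (intro mult_mono) auto
          then show ?thesis using t by simp
        next
          case False
          then show ?thesis using d(2)[OF True] w1(1)[of \<xi>] by simp
        qed
        moreover have "exp (- a * d\<^sup>2) * \<bar>g \<xi>\<bar> \<ge> 0" by simp
        ultimately show ?thesis by linarith
      next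
        case False
        then have "d \<le> norm (\<xi> - \<xi>0)" by (simp add: dist_norm)
        then have "d\<^sup>2 \<le> (norm (\<xi> - \<xi>0))\<^sup>2" using d by (intro power_mono) auto
        then have "w a \<xi> \<le> exp (- a * d\<^sup>2)" unfolding w_def using a by simp
        then have "w a \<xi> * \<bar>g \<xi>\<bar> \<le> exp (- a * d\<^sup>2) * \<bar>g \<xi>\<bar>" by (intro mult_right_mono) auto
        moreover have "- (w a \<xi> * \<bar>g \<xi>\<bar>) \<le> g \<xi> * w a \<xi>"
          using abs_ge_minus_self[of "g \<xi> * w a \<xi>"] w1(1)[of \<xi>] by (simp add: abs_mult mult.commute)
        moreover have "\<xi> \<notin> ball \<xi>0 (d / 2)" using False d by (simp add: dist_commute)
        ultimately show ?thesis by simp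
      qed
    qed
    also have "(LINT \<xi>|lborel. ?lo \<xi>) = 1 / 2 * exp (- a * (d / 2)\<^sup>2) * V - exp (- a * d\<^sup>2) * G"
      unfolding V_def G_def using ib ig
      by (subst Bochner_Integration.integral_diff) (auto intro!: integrable_mult_right integrable_abs)
    finally have "1 / 2 * exp (- a * (d / 2)\<^sup>2) * V \<le> exp (- a * d\<^sup>2) * G" using z by simp
    then have "exp (a * (d / 2)\<^sup>2) * (1 / 2 * exp (- a * (d / 2)\<^sup>2) * V) \<le> exp (a * (d / 2)\<^sup>2) * (exp (- a * d\<^sup>2) * G)"
      by (intro mult_left_mono) auto
    then have "(exp (a * (d / 2)\<^sup>2) * exp (- a * (d / 2)\<^sup>2)) * (V / 2) \<le> (exp (a * (d / 2)\<^sup>2) * exp (- a * d\<^sup>2)) * G"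
      by (simp only: mult_ac divide_inverse mult_1)
    moreover have "exp (a * (d / 2)\<^sup>2) * exp (- a * (d / 2)\<^sup>2) = 1"
      unfolding exp_add[symmetric] by simp
    moreover have "exp (a * (d / 2)\<^sup>2) * exp (- a * d\<^sup>2) = exp (- (3 / 4) * d\<^sup>2 * a)"
      unfolding exp_add[symmetric] by (rule arg_cong[where f = exp]) (simp add: power2_eq_square algebra_simps)
    ultimately show ?thesis by (simp only: mult_1)
  qed
  have "((\<lambda>a. exp (- (3 / 4) * d\<^sup>2 * a) * G) \<longlongrightarrow> 0) at_top"
    using d(1) by real_asymp
  moreover have "eventually (\<lambda>a. V / 2 \<le> exp (- (3 / 4) * d\<^sup>2 * a) * G) at_top"
    using eventually_gt_at_top[of 0] by (rule eventually_mono) (rule ineq)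
  ultimately have "V / 2 \<le> 0" by (rule tendsto_lowerbound) simp
  then show False using V by simp
qed

context
  fixes Q :: "real ^ 'd \<Rightarrow> real ^ 'n" and A :: "'n \<Rightarrow> real ^ 'd ^ 'd"
  assumes sym: "\<And>j. transpose (A j) = A j" and Q: "\<And>\<xi> N. Q \<xi> \<bullet> N = \<xi> \<bullet> (pencil A N *v \<xi>)"
begin

text \<open>The Gaussians \<open>exp (- (a + \<i> t (l j)) s\<^sup>2)\<close> in the eigendirections, centred at \<open>\<xi>0\<close>, cancel the quadratic phase
up to a linear one, which a suitable \<open>y\<close> removes. What remains is a real Gaussian mean of \<open>f\<close>.\<close>

lemma osc_gaussian_mean_bound:
  fixes f :: "real ^ 'd \<Rightarrow> complex" and u :: "'d \<Rightarrow> real ^ 'd"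
  assumes u: "\<And>i j. u i \<bullet> u j = (if i = j then 1 else 0)" and l: "\<And>i. pencil A N *v u i = l i *\<^sub>R u i"
    and a: "a > 0" and f: "integrable lborel f"
    and D: "\<And>y. norm (osc Q f y (t *\<^sub>R N)) \<le> D"
  shows "norm (LINT \<xi>|lborel. f \<xi> * of_real (exp (- a * (norm (\<xi> - \<xi>0))\<^sup>2)))
    \<le> D * (\<Prod>j\<in>UNIV. sqrt (norm (Complex a (t * l j)) / a))"
proof -
  define B where "B = pencil A N"
  have symB: "transpose B = B" unfolding B_def by (rule transpose_pencil[OF sym])
  have QB: "Q \<xi> \<bullet> N = \<xi> \<bullet> (B *v \<xi>)" for \<xi> by (simp add: Q B_def)
  define F where "F \<xi> = exp (\<i> * of_real (t * (\<xi> \<bullet> (B *v \<xi>)))) * f \<xi>" for \<xi>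
  have cB: "continuous_on UNIV (\<lambda>\<xi>. \<xi> \<bullet> (B *v \<xi>))"
    by (intro continuous_intros linear_continuous_on matrix_vector_mul_bounded_linear)
  have [measurable]: "f \<in> borel_measurable borel" using f by simp
  have iF: "integrable lborel F"
  proof (rule Bochner_Integration.integrable_bound[OF f])
    have "(\<lambda>\<xi>. exp (\<i> * of_real (t * (\<xi> \<bullet> (B *v \<xi>))))) \<in> borel_measurable borel"
      by (intro borel_measurable_continuous_onI continuous_intros cB)
    then show "F \<in> borel_measurable lborel" unfolding F_def by simp
    have "norm (F \<xi>) = norm (f \<xi>)" for \<xi> unfolding F_def norm_mult norm_exp_i_times by simp
    then show "AE \<xi> in lborel. norm (F \<xi>) \<le> norm (f \<xi>)" by simp
  qed
  have FD: "norm (LINT \<xi>|lborel. exp (\<i> * of_real (y \<bullet> \<xi>)) * F \<xi>) \<le> D" for y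
  proof -
    have "exp (\<i> * of_real (y \<bullet> \<xi>)) * F \<xi> = exp (\<i> * of_real (y \<bullet> \<xi> + Q \<xi> \<bullet> (t *\<^sub>R N))) * f \<xi>" for \<xi>
      by (simp add: F_def QB exp_add distrib_left mult.assoc)
    then show ?thesis using D[of y] by (simp add: osc_def)
  qed
  define p where "p j = Complex a (t * l j)" for j
  have Rep: "Re (p j) = a" for j by (simp add: p_def)
  \<comment> \<open>The gradient of the phase \<open>t (Q \<bullet> N)\<close> at \<open>\<xi>0\<close>, with opposite sign.\<close>
  define y where "y = (- 2 * t) *\<^sub>R (B *v \<xi>0)"
  have "norm (LINT \<xi>|lborel. exp (\<i> * of_real (y \<bullet> \<xi>)) * (F \<xi> * (\<Prod>j\<in>UNIV. exp (- p j * of_real ((u j \<bullet> \<xi> - u j \<bullet> \<xi>0)\<^sup>2)))))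
      \<le> D * (\<Prod>j\<in>UNIV. sqrt (norm (p j) / Re (p j)))"
    using gaussian_product_multiplier_bound[of UNIV p F D u "\<lambda>j. u j \<bullet> \<xi>0"] iF FD a Rep by simp
  moreover have "exp (\<i> * of_real (y \<bullet> \<xi>)) * (F \<xi> * (\<Prod>j\<in>UNIV. exp (- p j * of_real ((u j \<bullet> \<xi> - u j \<bullet> \<xi>0)\<^sup>2))))
      = exp (\<i> * of_real (- t * (\<xi>0 \<bullet> (B *v \<xi>0)))) * (f \<xi> * of_real (exp (- a * (norm (\<xi> - \<xi>0))\<^sup>2)))" for \<xi>
  proof -
    define v where "v = \<xi> - \<xi>0"
    have s1: "(\<Sum>j\<in>UNIV. (u j \<bullet> v)\<^sup>2) = (norm v)\<^sup>2"
    proof -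
      have "(norm v)\<^sup>2 = v \<bullet> v" by (simp add: dot_square_norm)
      also have "\<dots> = (\<Sum>j\<in>UNIV. (v \<bullet> u j) * (u j \<bullet> v))" by (rule inner_orthonormal_expansion[OF u])
      finally show ?thesis by (simp add: power2_eq_square inner_commute)
    qed
    have s2: "(\<Sum>j\<in>UNIV. l j * (u j \<bullet> v)\<^sup>2) = v \<bullet> (B *v v)"
      using quadratic_form_eigenbasis[OF u l[folded B_def] symB, of v] by simp
    have "(\<Sum>j\<in>UNIV. - p j * of_real ((u j \<bullet> \<xi> - u j \<bullet> \<xi>0)\<^sup>2)) = (\<Sum>j\<in>UNIV. of_real (- a * (u j \<bullet> v)\<^sup>2) + \<i> * of_real (- t * (l j * (u j \<bullet> v)\<^sup>2)))"
      by (intro sum.cong refl) (simp add: p_def v_def inner_diff_right complex_eq_iff)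
    also have "\<dots> = of_real (- a * (norm v)\<^sup>2) + \<i> * of_real (- t * (v \<bullet> (B *v v)))"
      by (simp only: sum.distrib sum_distrib_left[symmetric] of_real_sum[symmetric] s1 s2)
    finally have prod: "(\<Prod>j\<in>UNIV. exp (- p j * of_real ((u j \<bullet> \<xi> - u j \<bullet> \<xi>0)\<^sup>2)))
        = exp (of_real (- a * (norm v)\<^sup>2) + \<i> * of_real (- t * (v \<bullet> (B *v v))))"
      by (simp only: exp_sum[OF finite, symmetric])
    have "y \<bullet> \<xi> + t * (\<xi> \<bullet> (B *v \<xi>)) - t * (v \<bullet> (B *v v)) = - t * (\<xi>0 \<bullet> (B *v \<xi>0))"
    proof -
      have "\<xi>0 \<bullet> (B *v \<xi>) = \<xi> \<bullet> (B *v \<xi>0)"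
        using symmetric_matrix_inner[OF symB, of \<xi>0 \<xi>] by (simp add: inner_commute)
      then show ?thesis
        by (simp add: y_def v_def inner_diff_left inner_diff_right matrix_vector_mult_diff_distrib algebra_simps inner_commute[of _ \<xi>])
    qed
    then have "\<i> * of_real (y \<bullet> \<xi>) + \<i> * of_real (t * (\<xi> \<bullet> (B *v \<xi>))) + (of_real (- a * (norm v)\<^sup>2) + \<i> * of_real (- t * (v \<bullet> (B *v v))))
        = \<i> * of_real (- t * (\<xi>0 \<bullet> (B *v \<xi>0))) + of_real (- a * (norm v)\<^sup>2)"
      by (simp add: complex_eq_iff)
    then have expeq: "exp (\<i> * of_real (y \<bullet> \<xi>)) * exp (\<i> * of_real (t * (\<xi> \<bullet> (B *v \<xi>)))) * exp (of_real (- a * (norm v)\<^sup>2) + \<i> * of_real (- t * (v \<bullet> (B *v v))))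
        = exp (\<i> * of_real (- t * (\<xi>0 \<bullet> (B *v \<xi>0)))) * of_real (exp (- a * (norm v)\<^sup>2))"
      by (simp only: exp_add[symmetric] exp_of_real[symmetric])
    have "b * ((c * f \<xi>) * e) = r * (f \<xi> * s)" if "b * c * e = r * s" for b c e r s :: complex
      using arg_cong[OF that, of "\<lambda>x. f \<xi> * x"] by (simp only: mult_ac)
    from this[OF expeq] show ?thesis unfolding F_def prod unfolding v_def .
  qed
  ultimately have "norm (exp (\<i> * of_real (- t * (\<xi>0 \<bullet> (B *v \<xi>0)))) * (LINT \<xi>|lborel. f \<xi> * of_real (exp (- a * (norm (\<xi> - \<xi>0))\<^sup>2))))
      \<le> D * (\<Prod>j\<in>UNIV. sqrt (norm (p j) / Re (p j)))"
    by (simp only: integral_mult_right_zero)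
  then show ?thesis unfolding norm_mult norm_exp_i_times by (simp add: Rep p_def)
qed

text \<open>In a normal direction of minimal rank only \<open>d_frak1 Q\<close> eigenvalues are nonzero, so recovering a Gaussian mean
of \<open>f\<close> from the oscillatory integrals costs at most a factor of order \<open>t powr (d_frak1 Q / 2)\<close>. Faster decay would
force all Gaussian means of \<open>f\<close> at \<open>\<xi>0\<close> to vanish.\<close>

theorem osc_decay_optimal:
  fixes f :: "real ^ 'd \<Rightarrow> complex"
  assumes f: "integrable lborel f" "continuous_on UNIV f" and nz: "f \<xi>0 \<noteq> 0"
    and \<gamma>: "\<gamma> > real (d_frak1 Q) / 2"
    and C: "\<And>y z. norm (osc Q f y z) \<le> C * (1 + norm (y, z)) powr (- \<gamma>)"
  shows False
proof -
  obtain N and u :: "'d \<Rightarrow> real ^ 'd" and l where N: "N \<noteq> 0"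
    and u: "\<And>i j. u i \<bullet> u j = (if i = j then 1 else 0)" and l: "\<And>i. pencil A N *v u i = l i *\<^sub>R u i"
    and card: "card {i. l i \<noteq> 0} \<le> d_frak1 Q"
    by (rule d_frak1_eigenvalues[OF sym Q]) blast
  define m where "m = real (d_frak1 Q)"
  have C0: "C \<ge> 0" using order_trans[OF norm_ge_zero C[of 0 0]] by simp
  have "(LINT \<xi>|lborel. f \<xi> * of_real (exp (- a * (norm (\<xi> - \<xi>0))\<^sup>2))) = 0" if a: "a > 0" for a
  proof -
    let ?I = "LINT \<xi>|lborel. f \<xi> * of_real (exp (- a * (norm (\<xi> - \<xi>0))\<^sup>2))"
    define K where "K = (a + (\<Sum>j\<in>UNIV. \<bar>l j\<bar>)) / a"
    have K: "K \<ge> 1" using a by (simp add: K_def le_divide_eq sum_nonneg)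
    have bound: "norm ?I \<le> C * norm N powr (- \<gamma>) * K powr (m / 2) * t powr (m / 2 - \<gamma>)" if t: "t \<ge> 1" for t
    proof -
      have "norm (osc Q f y (t *\<^sub>R N)) \<le> C * (t * norm N) powr (- \<gamma>)" for y
      proof -
        have "t * norm N \<le> 1 + norm (y, t *\<^sub>R N)"
          using norm_snd_le[of "t *\<^sub>R N" y] t by simp
        then have "(1 + norm (y, t *\<^sub>R N)) powr (- \<gamma>) \<le> (t * norm N) powr (- \<gamma>)"
          using t N \<gamma> by (intro powr_mono2') auto
        then show ?thesis using C[of y "t *\<^sub>R N"] C0 by (meson mult_left_mono order_trans)
      qed
      from osc_gaussian_mean_bound[OF u l a f(1) this, of \<xi>0]
      have 1: "norm ?I \<le> C * (t * norm N) powr (- \<gamma>) * (\<Prod>j\<in>UNIV. sqrt (norm (Complex a (t * l j)) / a))" .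
      have "(\<Prod>j\<in>UNIV. sqrt (norm (Complex a (t * l j)) / a)) \<le> (\<Prod>j\<in>UNIV. if l j \<noteq> 0 then sqrt (K * t) else 1)"
      proof (intro prod_mono conjI)
        fix j
        show "sqrt (norm (Complex a (t * l j)) / a) \<le> (if l j \<noteq> 0 then sqrt (K * t) else 1)"
        proof (cases "l j = 0")
          case False
          have "norm (Complex a (t * l j)) \<le> \<bar>a\<bar> + \<bar>t * l j\<bar>" using cmod_le[of "Complex a (t * l j)"] by simp
          also have "\<dots> \<le> a * t + t * (\<Sum>j\<in>UNIV. \<bar>l j\<bar>)"
            using a t by (intro add_mono) (auto simp: abs_mult intro!: member_le_sum mult_left_mono)
          also have "\<dots> = K * t * a" using a by (simp add: K_def field_simps)
          finally show ?thesis using False a by (simp add: divide_le_eq)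
        qed (use a in \<open>simp add: complex_norm\<close>)
      qed (use a in auto)
      also have "\<dots> = sqrt (K * t) ^ card {i. l i \<noteq> 0}"
        by (simp add: prod.If_cases)
      also have "\<dots> \<le> sqrt (K * t) ^ d_frak1 Q"
        using K t card mult_mono[of 1 K 1 t] by (intro power_increasing) auto
      also have "\<dots> = (K * t) powr (m / 2)"
        using K t by (simp add: m_def powr_half_sqrt[symmetric] powr_realpow[symmetric] powr_powr)
      finally have "norm ?I \<le> C * (t * norm N) powr (- \<gamma>) * (K * t) powr (m / 2)"
        using 1 C0 by (meson mult_left_mono mult_nonneg_nonneg order_trans powr_ge_zero)
      also have "\<dots> = C * norm N powr (- \<gamma>) * K powr (m / 2) * t powr (m / 2 - \<gamma>)"
      proof -
        have "(t * norm N) powr (- \<gamma>) = t powr (- \<gamma>) * norm N powr (- \<gamma>)" "(K * t) powr (m / 2) = K powr (m / 2) * t powr (m / 2)"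
          using t K by (simp_all add: powr_mult)
        moreover have "t powr (m / 2 - \<gamma>) = t powr (m / 2) * t powr (- \<gamma>)" by (simp add: powr_add[symmetric])
        ultimately show ?thesis by (simp only: mult_ac)
      qed
      finally show ?thesis .
    qed
    have "((\<lambda>t. C * norm N powr (- \<gamma>) * K powr (m / 2) * t powr (m / 2 - \<gamma>)) \<longlongrightarrow> C * norm N powr (- \<gamma>) * K powr (m / 2) * 0) at_top"
      using \<gamma> by (intro tendsto_mult tendsto_const tendsto_neg_powr filterlim_ident) (simp add: m_def)
    moreover have "eventually (\<lambda>t. norm ?I \<le> C * norm N powr (- \<gamma>) * K powr (m / 2) * t powr (m / 2 - \<gamma>)) at_top"
      using eventually_ge_at_top[of 1] by (rule eventually_mono) (rule bound)
    ultimately have "norm ?I \<le> C * norm N powr (- \<gamma>) * K powr (m / 2) * 0"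
      by (rule tendsto_lowerbound) simp
    then show ?thesis by simp
  qed
  from gaussian_means_determine_value[OF f this] nz show False by simp
qed

end

section \<open>The decay of the extension operator applied to a constant\<close>

theorem corollary3p8:
  fixes Q :: "real ^ 'd \<Rightarrow> real ^ 'n" and \<phi> :: "real ^ 'd \<Rightarrow> complex"
  assumes "\<And>j. quadratic_form (\<lambda>\<xi>. Q \<xi> $ j)"
    and "test_function \<phi>"
    and "\<exists>\<xi>. \<phi> \<xi> \<noteq> 0"
  shows "(\<exists>C::real. \<forall>x. norm (ext_op Q \<phi> (\<lambda>_. 1) x)
            \<le> C * (1 + norm x) powr (- (real (d_frak1 Q) / 2)))
       \<and> (\<forall>\<gamma>::real. \<gamma> > real (d_frak1 Q) / 2 \<longrightarrow>
            \<not> (\<exists>C::real. \<forall>x. norm (ext_op Q \<phi> (\<lambda>_. 1) x) \<le> C * (1 + norm x) powr (- \<gamma>)))"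
proof -
  obtain A :: "'n \<Rightarrow> real ^ 'd ^ 'd" where sym: "\<And>j. transpose (A j) = A j"
    and Q: "\<And>\<xi> N. Q \<xi> \<bullet> N = \<xi> \<bullet> (pencil A N *v \<xi>)"
    using quadratic_forms_symmetric_matrices[OF assms(1)] by blast
  have ext: "ext_op Q \<phi> (\<lambda>_. 1) x = osc Q \<phi> (fst x) (snd x)" for x
    unfolding ext_op_def osc_def inner_prod_def by (simp add: inner_commute)
  obtain \<xi>0 where \<xi>0: "\<phi> \<xi>0 \<noteq> 0" using assms(3) by blast
  show ?thesis
  proof (intro conjI allI impI notI)
    show "\<exists>C::real. \<forall>x. norm (ext_op Q \<phi> (\<lambda>_. 1) x) \<le> C * (1 + norm x) powr (- (real (d_frak1 Q) / 2))"
      using osc_decay[OF sym Q assms(2)] unfolding ext by (metis prod.collapse)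
    fix \<gamma> :: real
    assume \<gamma>: "\<gamma> > real (d_frak1 Q) / 2"
      and "\<exists>C::real. \<forall>x. norm (ext_op Q \<phi> (\<lambda>_. 1) x) \<le> C * (1 + norm x) powr (- \<gamma>)"
    then obtain C where C: "\<And>x. norm (osc Q \<phi> (fst x) (snd x)) \<le> C * (1 + norm x) powr (- \<gamma>)"
      unfolding ext by blast
    show False
      by (rule osc_decay_optimal[OF sym Q integrable_test_function[OF assms(2)]
            test_function_continuous[OF assms(2)] \<xi>0 \<gamma>])
         (use C[of "(_, _)"] in simp)
  qed
qed

end
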